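(* Assume that $H_1(y)$ has full row rank. Then the output data $y(0),y(1),\dots,y(T)$ are informative for quadratic stability if and only if there exists $\Phi\in\mathbb{S}^{pL}$ such that $\Phi>0$ and $$\begin{bmatrix}\Phi-\begin{bmatrix}J\\ 0\end{bmatrix}\Phi\begin{bmatrix}J\\ 0\end{bmatrix}^\top & -\begin{bmatrix}J\\ 0\end{bmatrix}\Phi\\[2mm] -\Phi\begin{bmatrix}J\\ 0\end{bmatrix}^\top & -\Phi\end{bmatrix}-\bar N>0 .$$ In that case (i.e. for any such $\Phi$) the QDF $Q_\Psi$ with $\Psi:=\Phi^{-1}$ is a Lyapunov function for all systems $P(\sigma)\boldsymbol{y}=\boldsymbol{v}$ of order $L$ that are compatible with the data.
   Context: Notation: $\mathbb{S}^n$ is the set of real symmetric $n\times n$ matrices; $>0,\ \geq 0,\ <0$ denote (semi)definiteness of symmetric matrices; $\dagger$ is the Moore-Penrose pseudo-inverse; $\mathbb{Z}_+$ is the set of nonnegative integers; $(\sigma \boldsymbol{f})(t)=\boldsymbol{f}(t+1)$. For a symmetric partitioned $\Pi$ put $\Pi\,|\,\Pi_{22}:=\Pi_{11}-\Pi_{12}\Pi_{22}^\dagger\Pi_{21}$. Systems: fix positive integers $p,L,T$ with $T\geq L$. The model class consists of systems $P(\sigma)\boldsymbol{y}=\boldsymbol{v}$ with $P(\xi)=I\xi^L+P_{L-1}\xi^{L-1}+\cdots+P_1\xi+P_0$, $P_i\in\mathbb{R}^{p\times p}$, where $\boldsymbol{y},\boldsymbol{v}:\mathbb{Z}_+\to\mathbb{R}^p$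 ($\boldsymbol{v}$ is unknown noise). The coefficient matrix is denoted $P=\begin{bmatrix}P_0&P_1&\cdots&P_{L-1}\end{bmatrix}\in\mathbb{R}^{p\times pL}$. The behavior $\mathcal{B}(P)$ is the set of all $\boldsymbol{y}:\mathbb{Z}_+\to\mathbb{R}^p$ with $P(\sigma)\boldsymbol{y}=0$. Noise model: $\Pi=\begin{bmatrix}\Pi_{11}&\Pi_{12}\\ \Pi_{21}&\Pi_{22}\end{bmatrix}\in\mathbb{S}^{p+T-L+1}$ is known, with $\Pi_{11}\in\mathbb{S}^p$, $\Pi_{22}\in\mathbb{S}^{T-L+1}$, $\Pi_{22}<0$ and $\Pi\,|\,\Pi_{22}\geq 0$. The matrix of noise samples $V=\begin{bmatrix}v(0)&\cdots&v(T-L)\end{bmatrix}$ satisfies $\begin{bmatrix}I\\ V^\top\end{bmatrix}^\top\Pi\begin{bmatrix}I\\ V^\top\end{bmatrix}\geq 0$. Data: $y(0),\dots,y(T)\in\mathbb{R}^p$. Let $H_1(y)\in\mathbb{R}^{pL\times(T-L+1)}$ be the block Hankel matrix whose $(i+1)$-th block row is $\begin{bmatrix}y(i)&y(i+1)&\cdots&y(T-L+i)\end{bmatrix}$, $i=0,\dots,L-1$, and $H_2(y)=\begin{bmatrix}y(L)&y(L+1)&\cdots&y(T)\end{bmatrix}$. Define $$N:=\begin{bmatrix}I&H_2(y)\\ 0&H_1(y)\end{bmatrix}\Pi\begin{bmatrix}I&H_2(y)\\ 0&H_1(y)\end{bmatrix}^\top\in\mathbb{S}^{p+pL}.$$ A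 system with coefficient matrix $P$ is compatible with the data if and only if $\begin{bmatrix}I\\ P^\top\end{bmatrix}^\top N\begin{bmatrix}I\\ P^\top\end{bmatrix}\geq 0$. The data are generated by a true system in the model class, with noise satisfying the noise model, so the set of compatible $P$ is nonempty. Further define $$\bar N:=\begin{bmatrix}\begin{bmatrix}0&-I_p\end{bmatrix}&0\\ 0&I_{pL}\end{bmatrix}^\top N\begin{bmatrix}\begin{bmatrix}0&-I_p\end{bmatrix}&0\\ 0&I_{pL}\end{bmatrix}\in\mathbb{S}^{2pL},$$ with $\begin{bmatrix}0&-I_p\end{bmatrix}\in\mathbb{R}^{p\times pL}$, and $J:=\begin{bmatrix}0_{p(L-1)\times p}&I_{p(L-1)}\end{bmatrix}\in\mathbb{R}^{p(L-1)\times pL}$ (void if $L=1$); $\begin{bmatrix}J\\ 0\end{bmatrix}\in\mathbb{R}^{pL\times pL}$. Informativity: the data are informative for quadratic stability if there exists $\Psi\in\mathbb{S}^{pL}$, $\Psi\geq0$, such that $$\begin{bmatrix}I\\ -P\end{bmatrix}^\top\left(\begin{bmatrix}0_p&0\\ 0&\Psi\end{bmatrix}-\begin{bmatrix}\Psi&0\\ 0&0_p\end{bmatrix}\right)\begin{bmatrix}I\\ -P\end{bmatrix}<0$$ holds for all $P$ compatible with the data. QDFs: for $\Psi\in\mathbb{S}^{pL}$ the quadratic difference form (QDF) is $Q_\Psi(\boldsymbol{y})(t)=\eta(t)^\top\Psi\eta(t)$, where $\eta(t)$ is the stacked vector of $\boldsymbol{y}(t),\dots,\boldsymbol{y}(t+L-1)$,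 and $Q_{\nabla\Psi}(\boldsymbol{y})(t)=Q_\Psi(\boldsymbol{y})(t+1)-Q_\Psi(\boldsymbol{y})(t)$. $Q_\Psi$ is a Lyapunov function for the system $P(\sigma)\boldsymbol{y}=\boldsymbol{v}$ if, for all $\boldsymbol{y}\in\mathcal{B}(P)$, $Q_\Psi(\boldsymbol{y})(t)\geq0$ for all $t$ and $Q_{\nabla\Psi}(\boldsymbol{y})(t)\leq0$ for all $t$, and moreover, for $\boldsymbol{y}\in\mathcal{B}(P)$, $Q_{\nabla\Psi}(\boldsymbol{y})$ is identically zero only if $\boldsymbol{y}=0$. *)

theory Defs
  imports
    "Jordan_Normal_Form.Gauss_Jordan_Elimination"
    "Jordan_Normal_Form.DL_Rank"
begin

section \<open>Symmetric matrices, definiteness and the pseudo-inverse\<close>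

definition sym_mat :: "nat \<Rightarrow> real mat set" where
  "sym_mat n = {A \<in> carrier_mat n n. transpose_mat A = A}"

definition pos_def :: "nat \<Rightarrow> real mat \<Rightarrow> bool" where
  "pos_def n A \<longleftrightarrow> A \<in> sym_mat n \<and>
     (\<forall>x \<in> carrier_vec n. x \<noteq> 0\<^sub>v n \<longrightarrow> x \<bullet> (A *\<^sub>v x) > 0)"

definition pos_semidef :: "nat \<Rightarrow> real mat \<Rightarrow> bool" where
  "pos_semidef n A \<longleftrightarrow> A \<in> sym_mat n \<and>
     (\<forall>x \<in> carrier_vec n. x \<bullet> (A *\<^sub>v x) \<ge> 0)"

definition neg_def :: "nat \<Rightarrow> real mat \<Rightarrow> bool" where
  "neg_def n A \<longleftrightarrow> A \<in> sym_mat n \<and>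
     (\<forall>x \<in> carrier_vec n. x \<noteq> 0\<^sub>v n \<longrightarrow> x \<bullet> (A *\<^sub>v x) < 0)"

definition is_pinv :: "real mat \<Rightarrow> real mat \<Rightarrow> bool" where
  "is_pinv A X \<longleftrightarrow> X \<in> carrier_mat (dim_col A) (dim_row A) \<and>
     A * X * A = A \<and> X * A * X = X \<and>
     transpose_mat (A * X) = A * X \<and> transpose_mat (X * A) = X * A"

definition pinv :: "real mat \<Rightarrow> real mat" where
  "pinv A = (THE X. is_pinv A X)"

definition gen_schur :: "real mat \<Rightarrow> real mat \<Rightarrow> real mat \<Rightarrow> real mat \<Rightarrow> real mat" where
  "gen_schur A11 A12 A21 A22 = A11 - A12 * pinv A22 * A21"

section \<open>Systems and behaviors\<close>

text \<open>A system is given by its coefficient matrix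
  \<open>P = [P\<^sub>0 P\<^sub>1 \<dots> P\<^sub>L\<^sub>-\<^sub>1]\<close> of size \<open>p \<times> p L\<close>; the leading coefficient is the identity.\<close>

definition coeff_block :: "nat \<Rightarrow> real mat \<Rightarrow> nat \<Rightarrow> real mat" where
  "coeff_block p P i = mat p p (\<lambda>(r, c). P $$ (r, i * p + c))"

definition shift_op :: "nat \<Rightarrow> nat \<Rightarrow> real mat \<Rightarrow> (nat \<Rightarrow> real vec) \<Rightarrow> nat \<Rightarrow> real vec" where
  "shift_op p L P y t =
     vec p (\<lambda>r. y (t + L) $ r + (\<Sum>i<L. (coeff_block p P i *\<^sub>v y (t + i)) $ r))"

definition behavior :: "nat \<Rightarrow> nat \<Rightarrow> real mat \<Rightarrow> (nat \<Rightarrow> real vec) set" where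
  "behavior p L P =
     {y. (\<forall>t. y t \<in> carrier_vec p) \<and> (\<forall>t. shift_op p L P y t = 0\<^sub>v p)}"

section \<open>Quadratic difference forms\<close>

definition stacked :: "nat \<Rightarrow> nat \<Rightarrow> (nat \<Rightarrow> real vec) \<Rightarrow> nat \<Rightarrow> real vec" where
  "stacked p L y t = vec (p * L) (\<lambda>k. y (t + k div p) $ (k mod p))"

definition qdf :: "nat \<Rightarrow> nat \<Rightarrow> real mat \<Rightarrow> (nat \<Rightarrow> real vec) \<Rightarrow> nat \<Rightarrow> real" where
  "qdf p L \<Psi> y t = stacked p L y t \<bullet> (\<Psi> *\<^sub>v stacked p L y t)"

definition qdf_rate :: "nat \<Rightarrow> nat \<Rightarrow> real mat \<Rightarrow> (nat \<Rightarrow> real vec) \<Rightarrow> nat \<Rightarrow> real" where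
  "qdf_rate p L \<Psi> y t = qdf p L \<Psi> y (t + 1) - qdf p L \<Psi> y t"

definition qdf_lyapunov :: "nat \<Rightarrow> nat \<Rightarrow> real mat \<Rightarrow> real mat \<Rightarrow> bool" where
  "qdf_lyapunov p L P \<Psi> \<longleftrightarrow> \<Psi> \<in> sym_mat (p * L) \<and>
     (\<forall>y \<in> behavior p L P.
        (\<forall>t. qdf p L \<Psi> y t \<ge> 0) \<and>
        (\<forall>t. qdf_rate p L \<Psi> y t \<le> 0) \<and>
        ((\<forall>t. qdf_rate p L \<Psi> y t = 0) \<longrightarrow> (\<forall>t. y t = 0\<^sub>v p)))"

section \<open>Data, noise model and compatible systems\<close>

definition noise_mat :: "nat \<Rightarrow> nat \<Rightarrow> nat \<Rightarrow> (nat \<Rightarrow> real vec) \<Rightarrow> real mat" where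
  "noise_mat p L T v = mat p (T - L + 1) (\<lambda>(r, j). v j $ r)"

definition noise_model :: "nat \<Rightarrow> real mat \<Rightarrow> real mat \<Rightarrow> bool" where
  "noise_model p Pm V \<longleftrightarrow>
     pos_semidef p (transpose_mat (1\<^sub>m p @\<^sub>r transpose_mat V) * Pm * (1\<^sub>m p @\<^sub>r transpose_mat V))"

text \<open>Only \<open>y 0, \<dots>, y T\<close> are data. They are generated by the system \<open>P\<close> if they are the
  restriction to \<open>{0..T}\<close> of a trajectory of that system whose noise samples at
  \<open>0, \<dots>, T - L\<close> obey the noise model.\<close>

definition data_generated_by ::
  "nat \<Rightarrow> nat \<Rightarrow> nat \<Rightarrow> real mat \<Rightarrow> (nat \<Rightarrow> real vec) \<Rightarrow> real mat \<Rightarrow> bool" where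
  "data_generated_by p L T Pm y P \<longleftrightarrow> P \<in> carrier_mat p (p * L) \<and>
     (\<exists>w v. (\<forall>t. w t \<in> carrier_vec p) \<and> (\<forall>t. v t \<in> carrier_vec p) \<and>
        (\<forall>t. shift_op p L P w t = v t) \<and>
        (\<forall>t\<le>T. w t = y t) \<and>
        noise_model p Pm (noise_mat p L T v))"

definition H1 :: "nat \<Rightarrow> nat \<Rightarrow> nat \<Rightarrow> (nat \<Rightarrow> real vec) \<Rightarrow> real mat" where
  "H1 p L T y = mat (p * L) (T - L + 1) (\<lambda>(k, j). y (k div p + j) $ (k mod p))"

definition H2 :: "nat \<Rightarrow> nat \<Rightarrow> nat \<Rightarrow> (nat \<Rightarrow> real vec) \<Rightarrow> real mat" where
  "H2 p L T y = mat p (T - L + 1) (\<lambda>(r, j). y (L + j) $ r)"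

definition data_block :: "nat \<Rightarrow> nat \<Rightarrow> nat \<Rightarrow> (nat \<Rightarrow> real vec) \<Rightarrow> real mat" where
  "data_block p L T y = four_block_mat (1\<^sub>m p) (H2 p L T y) (0\<^sub>m (p * L) p) (H1 p L T y)"

definition N_mat :: "nat \<Rightarrow> nat \<Rightarrow> nat \<Rightarrow> real mat \<Rightarrow> (nat \<Rightarrow> real vec) \<Rightarrow> real mat" where
  "N_mat p L T Pm y = data_block p L T y * Pm * transpose_mat (data_block p L T y)"

definition compatible ::
  "nat \<Rightarrow> nat \<Rightarrow> nat \<Rightarrow> real mat \<Rightarrow> (nat \<Rightarrow> real vec) \<Rightarrow> real mat \<Rightarrow> bool" where
  "compatible p L T Pm y P \<longleftrightarrow> P \<in> carrier_mat p (p * L) \<and>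
     pos_semidef p (transpose_mat (1\<^sub>m p @\<^sub>r transpose_mat P) * N_mat p L T Pm y *
                    (1\<^sub>m p @\<^sub>r transpose_mat P))"

section \<open>Quadratic stability and the linear matrix inequality\<close>

definition informative_quadratic_stability ::
  "nat \<Rightarrow> nat \<Rightarrow> nat \<Rightarrow> real mat \<Rightarrow> (nat \<Rightarrow> real vec) \<Rightarrow> bool" where
  "informative_quadratic_stability p L T Pm y \<longleftrightarrow>
     (\<exists>\<Psi>. pos_semidef (p * L) \<Psi> \<and>
        (\<forall>P. compatible p L T Pm y P \<longrightarrow>
           neg_def (p * L)
             (transpose_mat (1\<^sub>m (p * L) @\<^sub>r (- P)) *
              (four_block_mat (0\<^sub>m p p) (0\<^sub>m p (p * L)) (0\<^sub>m (p * L) p) \<Psi> -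
               four_block_mat \<Psi> (0\<^sub>m (p * L) p) (0\<^sub>m p (p * L)) (0\<^sub>m p p)) *
              (1\<^sub>m (p * L) @\<^sub>r (- P)))))"

text \<open>\<open>J0\<close> is \<open>J\<close> with \<open>p\<close> zero rows appended; for \<open>L = 1\<close> the upper blocks have no rows
  and \<open>J0\<close> is the \<open>p \<times> p\<close> zero matrix.\<close>

definition J0 :: "nat \<Rightarrow> nat \<Rightarrow> real mat" where
  "J0 p L = four_block_mat (0\<^sub>m (p * (L - 1)) p) (1\<^sub>m (p * (L - 1)))
                           (0\<^sub>m p p) (0\<^sub>m p (p * (L - 1)))"

text \<open>The row block \<open>[0 -I]\<close> is written as a block matrix with an empty lower block row.\<close>

definition E_mat :: "nat \<Rightarrow> nat \<Rightarrow> real mat" where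
  "E_mat p L = four_block_mat
     (four_block_mat (0\<^sub>m p (p * (L - 1))) (- 1\<^sub>m p) (0\<^sub>m 0 (p * (L - 1))) (0\<^sub>m 0 p))
     (0\<^sub>m p (p * L)) (0\<^sub>m (p * L) (p * L)) (1\<^sub>m (p * L))"

definition N_bar :: "nat \<Rightarrow> nat \<Rightarrow> nat \<Rightarrow> real mat \<Rightarrow> (nat \<Rightarrow> real vec) \<Rightarrow> real mat" where
  "N_bar p L T Pm y = transpose_mat (E_mat p L) * N_mat p L T Pm y * E_mat p L"

definition stability_lmi ::
  "nat \<Rightarrow> nat \<Rightarrow> nat \<Rightarrow> real mat \<Rightarrow> (nat \<Rightarrow> real vec) \<Rightarrow> real mat \<Rightarrow> bool" where
  "stability_lmi p L T Pm y \<Phi> \<longleftrightarrow>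
     pos_def (2 * (p * L))
       (four_block_mat
          (\<Phi> - J0 p L * \<Phi> * transpose_mat (J0 p L))  (- (J0 p L * \<Phi>))
          (- (\<Phi> * transpose_mat (J0 p L)))           (- \<Phi>)
        - N_bar p L T Pm y)"

section \<open>Compatibility in terms of the system equations\<close>

lemma shift_op_eq:
  assumes P: "P \<in> carrier_mat p (p * L)" and p: "p > 0"
    and w: "\<And>t. t \<le> T \<Longrightarrow> w t \<in> carrier_vec p" and j: "j + L \<le> T" and r: "r < p"
  shows "shift_op p L P w j $ r = w (j + L) $ r + row P r \<bullet> stacked p L w j"
proof -
  have 1: "(coeff_block p P i *\<^sub>v w (j + i)) $ r =
      (\<Sum>k\<in>{i * p..<i * p + p}. P $$ (r, k) * w (j + k div p) $ (k mod p))" if i: "i < L" for i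
  proof -
    have "w (j + i) \<in> carrier_vec p" using w j i by simp
    then have "(coeff_block p P i *\<^sub>v w (j + i)) $ r =
        (\<Sum>c\<in>{0..<p}. P $$ (r, i * p + c) * w (j + i) $ c)"
      using r by (simp add: coeff_block_def scalar_prod_def)
    also have "\<dots> = (\<Sum>c\<in>{0..<p}. P $$ (r, c + i * p) * w (j + (c + i * p) div p) $ ((c + i * p) mod p))"
      by (rule sum.cong) (auto simp: add.commute)
    also have "\<dots> = (\<Sum>k\<in>{0 + i * p..<p + i * p}. P $$ (r, k) * w (j + k div p) $ (k mod p))"
      by (rule sum.shift_bounds_nat_ivl[symmetric])
    finally show ?thesis by (simp add: add.commute)
  qed
  have "(\<Sum>i<L. (coeff_block p P i *\<^sub>v w (j + i)) $ r) =
      (\<Sum>k<L * p. P $$ (r, k) * w (j + k div p) $ (k mod p))"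
    by (simp add: 1 sum.nat_group)
  also have "\<dots> = row P r \<bullet> stacked p L w j"
    using P r by (auto simp: scalar_prod_def stacked_def atLeast0LessThan mult.commute intro!: sum.cong)
  finally show ?thesis using r by (simp add: shift_op_def)
qed

lemma noise_mat_eq:
  assumes P: "P \<in> carrier_mat p (p * L)" and p: "p > 0" and LT: "L \<le> T"
    and w: "\<And>t. t \<le> T \<Longrightarrow> w t \<in> carrier_vec p"
    and v: "\<And>t. t + L \<le> T \<Longrightarrow> shift_op p L P w t = v t"
  shows "noise_mat p L T v = H2 p L T w + P * H1 p L T w"
proof (rule eq_matI)
  fix r j assume "r < dim_row (H2 p L T w + P * H1 p L T w)"
    and "j < dim_col (H2 p L T w + P * H1 p L T w)"
  then have r: "r < p" and j: "j < T - L + 1" using P by (auto simp: H1_def)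
  then have jT: "j + L \<le> T" using LT by simp
  have "shift_op p L P w j $ r = w (j + L) $ r + row P r \<bullet> stacked p L w j"
    using P p w jT r by (rule shift_op_eq)
  moreover have "col (H1 p L T w) j = stacked p L w j"
    using j by (auto simp: H1_def stacked_def add.commute)
  ultimately have sh: "shift_op p L P w j $ r = w (j + L) $ r + row P r \<bullet> col (H1 p L T w) j"
    by simp
  then show "noise_mat p L T v $$ (r, j) = (H2 p L T w + P * H1 p L T w) $$ (r, j)"
    using r j P sh v[OF jT]
    by (simp add: noise_mat_def H2_def H1_def add.commute)
qed (use P in \<open>auto simp: noise_mat_def H1_def\<close>)

lemma data_block_mult:
  assumes P: "P \<in> carrier_mat p (p * L)"
  shows "transpose_mat (data_block p L T y) * (1\<^sub>m p @\<^sub>r transpose_mat P) =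
    1\<^sub>m p @\<^sub>r transpose_mat (H2 p L T y + P * H1 p L T y)"
proof -
  let ?n = "T - L + 1"
  have h1: "H1 p L T y \<in> carrier_mat (p * L) ?n" and h2: "H2 p L T y \<in> carrier_mat p ?n"
    by (auto simp: H1_def H2_def)
  have "transpose_mat (data_block p L T y) = four_block_mat (1\<^sub>m p) (0\<^sub>m p (p * L))
      (transpose_mat (H2 p L T y)) (transpose_mat (H1 p L T y))"
    unfolding data_block_def
    by (subst transpose_four_block_mat[OF one_carrier_mat h2 zero_carrier_mat h1]) simp
  moreover have "1\<^sub>m p @\<^sub>r transpose_mat P =
      four_block_mat (1\<^sub>m p) (0\<^sub>m p 0) (transpose_mat P) (0\<^sub>m (p * L) 0)"
    using P by (simp add: append_rows_def)
  moreover have "four_block_mat (1\<^sub>m p) (0\<^sub>m p (p * L))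
      (transpose_mat (H2 p L T y)) (transpose_mat (H1 p L T y)) *
      four_block_mat (1\<^sub>m p) (0\<^sub>m p 0) (transpose_mat P) (0\<^sub>m (p * L) 0) =
      four_block_mat (1\<^sub>m p) (0\<^sub>m p 0)
       (transpose_mat (H2 p L T y) + transpose_mat (H1 p L T y) * transpose_mat P) (0\<^sub>m ?n 0)"
    using h1 h2 P
    by (subst mult_four_block_mat[where ?nr1.0 = p and ?n1.0 = p and ?n2.0 = "p * L"
          and ?nr2.0 = ?n and ?nc1.0 = p and ?nc2.0 = 0]) auto
  moreover have "transpose_mat (H2 p L T y + P * H1 p L T y) =
      transpose_mat (H2 p L T y) + transpose_mat (H1 p L T y) * transpose_mat P"
    using h1 h2 P by (simp add: transpose_add[of _ p ?n] transpose_mult[of _ p "p * L" _ ?n])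
  ultimately show ?thesis using h1 h2 P by (simp add: append_rows_def)
qed

lemma compatible_iff_noise_model:
  assumes P: "P \<in> carrier_mat p (p * L)" and LT: "L \<le> T"
    and Pi: "Pm \<in> carrier_mat (p + (T - L + 1)) (p + (T - L + 1))"
  shows "compatible p L T Pm y P \<longleftrightarrow> noise_model p Pm (H2 p L T y + P * H1 p L T y)"
proof -
  let ?D = "data_block p L T y" and ?S = "1\<^sub>m p @\<^sub>r transpose_mat P"
  let ?m = "p + (T - L + 1)" and ?k = "p + p * L"
  have D: "?D \<in> carrier_mat ?k ?m"
    by (auto simp: data_block_def H1_def H2_def)
  have S: "?S \<in> carrier_mat ?k p" using P by auto
  have "transpose_mat ?S * (?D * Pm * transpose_mat ?D) * ?S =
      (transpose_mat ?S * ?D) * Pm * (transpose_mat ?D * ?S)"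
  proof -
    have "transpose_mat ?S * (?D * Pm * transpose_mat ?D) =
        transpose_mat ?S * (?D * Pm) * transpose_mat ?D"
      using D S Pi by (intro assoc_mult_mat[symmetric, of _ p ?k _ ?m _ ?k]) auto
    also have "transpose_mat ?S * (?D * Pm) = transpose_mat ?S * ?D * Pm"
      using D S Pi by (intro assoc_mult_mat[symmetric, of _ p ?k _ ?m _ ?m]) auto
    finally show ?thesis
      using D S Pi by (simp add: assoc_mult_mat[of _ p ?m _ ?k _ p])
  qed
  also have "transpose_mat ?S * ?D = transpose_mat (transpose_mat ?D * ?S)"
    using D S by (simp add: transpose_mult[of _ ?m ?k _ p])
  finally show ?thesis
    using P unfolding compatible_def noise_model_def N_mat_def data_block_mult[OF P] by simp
qed

lemma data_generated_by_iff_compatible: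
  assumes p: "p > 0" and LT: "L \<le> T"
    and y: "\<And>t. t \<le> T \<Longrightarrow> y t \<in> carrier_vec p"
    and Pi: "Pm \<in> carrier_mat (p + (T - L + 1)) (p + (T - L + 1))"
  shows "data_generated_by p L T Pm y P \<longleftrightarrow> compatible p L T Pm y P"
proof (cases "P \<in> carrier_mat p (p * L)")
  case P: True
  have H: "H2 p L T w + P * H1 p L T w = H2 p L T y + P * H1 p L T y"
    if w: "\<And>t. t \<le> T \<Longrightarrow> w t = y t" for w
  proof -
    have "k div p + j \<le> T" if "k < p * L" "j < T - L + 1" for k j
    proof -
      have "k div p < L" using that p by (simp add: less_mult_imp_div_less mult.commute)
      then show ?thesis using that LT by simp
    qed
    then have "H1 p L T w = H1 p L T y" "H2 p L T w = H2 p L T y"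
      using LT by (auto simp: H1_def H2_def w intro!: eq_matI)
    then show ?thesis by simp
  qed
  show ?thesis
  proof
    assume "data_generated_by p L T Pm y P"
    then obtain w v where wv: "\<And>t. w t \<in> carrier_vec p" "\<And>t. shift_op p L P w t = v t"
      "\<And>t. t \<le> T \<Longrightarrow> w t = y t" "noise_model p Pm (noise_mat p L T v)"
      unfolding data_generated_by_def by blast
    have "noise_mat p L T v = H2 p L T y + P * H1 p L T y"
      using noise_mat_eq[OF P p LT wv(1,2)] H[OF wv(3)] by simp
    then show "compatible p L T Pm y P"
      using wv(4) by (simp add: compatible_iff_noise_model[OF P LT Pi])
  next
    assume c: "compatible p L T Pm y P"
    define w where "w t = (if t \<le> T then y t else 0\<^sub>v p)" for t
    have w: "w t \<in> carrier_vec p" for t using y by (simp add: w_def)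
    have "noise_mat p L T (shift_op p L P w) = H2 p L T w + P * H1 p L T w"
      by (rule noise_mat_eq[OF P p LT w refl])
    also have "\<dots> = H2 p L T y + P * H1 p L T y"
      by (rule H) (simp add: w_def)
    finally have "noise_model p Pm (noise_mat p L T (shift_op p L P w))"
      using c by (simp add: compatible_iff_noise_model[OF P LT Pi])
    then show "data_generated_by p L T Pm y P"
      unfolding data_generated_by_def
      by (intro conjI P exI[of _ w] exI[of _ "shift_op p L P w"]) (auto simp: w, auto simp: w_def shift_op_def)
  qed
qed (simp add: data_generated_by_def compatible_def)

end

theory Submission
  imports Defs "HOL-Analysis.Elementary_Topology"
begin

text \<open>
  Write \<open>n = p L\<close> and let \<open>C\<^sub>P\<close> be the companion matrix, whose rows are those of \<open>J\<close> followed by those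
  of \<open>- P\<close>; it maps the stacked vector of a trajectory at time \<open>t\<close> to the one at time \<open>t + 1\<close>. The
  vector \<open>[I; -P] x\<close> consists of the first \<open>p\<close> coordinates of \<open>x\<close> followed by \<open>C\<^sub>P x\<close>, so that the
  inequality in the definition of informativity is just the Stein inequality
  \<open>C\<^sub>P\<^sup>T \<Psi> C\<^sub>P < \<Psi>\<close> (\<open>quadratic_stability_iff_contraction\<close>). It forces \<open>\<Psi> > 0\<close>, since a compatible
  \<open>P\<close> exists, and for \<open>\<Phi> = \<Psi>\<inverse>\<close> it is equivalent to the dual inequality \<open>C\<^sub>P \<Phi> C\<^sub>P\<^sup>T < \<Phi>\<close>
  (\<open>contraction_inverse_form\<close>). Applying the Stein inequality along a trajectory shows that \<open>Q\<^sub>\<Psi>\<close>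
  is a Lyapunov function (\<open>contraction_imp_qdf_lyapunov\<close>).

  It remains to compare the dual inequality for all compatible \<open>P\<close> with the linear matrix
  inequality. At \<open>(x, w)\<close> the latter says
  \<open>x\<^sup>T \<Phi> x - (J\<^sub>0\<^sup>T x + w)\<^sup>T \<Phi> (J\<^sub>0\<^sup>T x + w) > N(u, w)\<close>,
  where \<open>J\<^sub>0\<close> is \<open>J\<close> with \<open>p\<close> zero rows appended, \<open>- u\<close> consists of the last \<open>p\<close> coordinates of
  \<open>x\<close>, and \<open>N(u, w)\<close> is the quadratic form of \<open>N\<close>.
  For \<open>w = P\<^sup>T u\<close> the vector \<open>J\<^sub>0\<^sup>T x + w\<close> is \<open>C\<^sub>P\<^sup>T x\<close>, and \<open>N(u, P\<^sup>T u) \<ge> 0\<close> for all \<open>u\<close> is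
  exactly compatibility of \<open>P\<close>. Hence the linear matrix inequality implies the dual inequality.

  Conversely, suppose that \<open>N(u, w) \<ge> 0\<close> and \<open>(x, w) \<noteq> 0\<close>. Because \<open>\<Pi>\<^sub>2\<^sub>2 < 0\<close> and \<open>H\<^sub>1(y)\<close> has full row
  rank, \<open>N\<close> is negative definite on the vectors \<open>(0, w)\<close>, and this makes it possible to find a
  compatible \<open>P\<close> with \<open>P\<^sup>T u = w\<close> (\<open>quadratic_matrix_inequality_interpolation\<close>). So the dual
  inequality for this \<open>P\<close> makes the left-hand side above positive whenever the right-hand side is
  nonnegative, and the S-lemma (\<open>strict_S_lemma\<close>) provides a \<open>\<beta> > 0\<close> for which \<open>\<beta> \<Phi>\<close> satisfies the
  linear matrix inequality.
\<close>

section \<open>Quadratic forms of symmetric matrices\<close>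

definition quad_form :: "real mat \<Rightarrow> real vec \<Rightarrow> real" where
  "quad_form A x = x \<bullet> (A *\<^sub>v x)"

lemma pos_def_iff_quad_form:
  "pos_def n A \<longleftrightarrow> A \<in> sym_mat n \<and> (\<forall>x \<in> carrier_vec n. x \<noteq> 0\<^sub>v n \<longrightarrow> quad_form A x > 0)"
  by (simp add: pos_def_def quad_form_def)

lemma pos_semidef_iff_quad_form:
  "pos_semidef n A \<longleftrightarrow> A \<in> sym_mat n \<and> (\<forall>x \<in> carrier_vec n. quad_form A x \<ge> 0)"
  by (simp add: pos_semidef_def quad_form_def)

lemma neg_def_iff_quad_form:
  "neg_def n A \<longleftrightarrow> A \<in> sym_mat n \<and> (\<forall>x \<in> carrier_vec n. x \<noteq> 0\<^sub>v n \<longrightarrow> quad_form A x < 0)"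
  by (simp add: neg_def_def quad_form_def)

lemma sym_mat_carrier: "A \<in> sym_mat n \<Longrightarrow> A \<in> carrier_mat n n"
  by (simp add: sym_mat_def)

lemma sym_mat_bilinear_commute:
  assumes A: "A \<in> sym_mat n" and x: "x \<in> carrier_vec n" and y: "y \<in> carrier_vec n"
  shows "x \<bullet> (A *\<^sub>v y) = y \<bullet> (A *\<^sub>v x)"
proof -
  have Ac: "A \<in> carrier_mat n n" and At: "transpose_mat A = A" using A by (auto simp: sym_mat_def)
  have "x \<bullet> (A *\<^sub>v y) = (transpose_mat A *\<^sub>v x) \<bullet> y"
    using transpose_vec_mult_scalar[OF Ac y x] by simp
  also have "\<dots> = y \<bullet> (A *\<^sub>v x)"
    unfolding At using Ac x y by (intro comm_scalar_prod[of _ n]) auto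
  finally show ?thesis .
qed

lemma mat_mult_zero_vec [simp]:
  "A \<in> carrier_mat nr nc \<Longrightarrow> A *\<^sub>v (0\<^sub>v nc :: real vec) = 0\<^sub>v nr"
  by (intro eq_vecI) auto

lemma zero_mat_mult_vec [simp]:
  "x \<in> carrier_vec nc \<Longrightarrow> 0\<^sub>m nr nc *\<^sub>v (x :: real vec) = 0\<^sub>v nr"
  by (intro eq_vecI) auto

lemma quad_form_zero_mat [simp]: "x \<in> carrier_vec n \<Longrightarrow> quad_form (0\<^sub>m n n) x = 0"
  by (simp add: quad_form_def)

lemma quad_form_zero [simp]: "A \<in> carrier_mat n n \<Longrightarrow> quad_form A (0\<^sub>v n) = 0"
  by (simp add: quad_form_def)

lemma quad_form_smult:
  assumes "A \<in> carrier_mat n n" and "x \<in> carrier_vec n"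
  shows "quad_form A (a \<cdot>\<^sub>v x) = a\<^sup>2 * quad_form A x"
  using assms by (simp add: quad_form_def mult_mat_vec power2_eq_square)

lemma quad_form_add:
  assumes A: "A \<in> sym_mat n" and x: "x \<in> carrier_vec n" and y: "y \<in> carrier_vec n"
  shows "quad_form A (x + y) = quad_form A x + 2 * (x \<bullet> (A *\<^sub>v y)) + quad_form A y"
proof -
  note Ac = sym_mat_carrier[OF A]
  have "quad_form A (x + y) = quad_form A x + x \<bullet> (A *\<^sub>v y) + (y \<bullet> (A *\<^sub>v x) + quad_form A y)"
    using Ac x y unfolding quad_form_def
    by (simp add: mult_add_distrib_mat_vec[of _ n n] add_scalar_prod_distrib[of _ n]
        scalar_prod_add_distrib[of _ n])
  then show ?thesis using sym_mat_bilinear_commute[OF A x y] by simp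
qed

lemma quad_form_lincomb:
  assumes A: "A \<in> sym_mat n" and x: "x \<in> carrier_vec n" and y: "y \<in> carrier_vec n"
  shows "quad_form A (a \<cdot>\<^sub>v x + b \<cdot>\<^sub>v y) =
    a\<^sup>2 * quad_form A x + 2 * a * b * (x \<bullet> (A *\<^sub>v y)) + b\<^sup>2 * quad_form A y"
  using quad_form_add[OF A, of "a \<cdot>\<^sub>v x" "b \<cdot>\<^sub>v y"] sym_mat_carrier[OF A] x y
  by (simp add: quad_form_smult mult_mat_vec)

lemma quad_form_minus_mat:
  assumes "A \<in> carrier_mat n n" and "B \<in> carrier_mat n n" and "x \<in> carrier_vec n"
  shows "quad_form (A - B) x = quad_form A x - quad_form B x"
proof -
  have "(A - B) *\<^sub>v x = A *\<^sub>v x - B *\<^sub>v x"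
    using assms by (simp add: minus_mult_distrib_mat_vec)
  then show ?thesis using assms by (simp add: quad_form_def scalar_prod_minus_distrib[of _ n])
qed

lemma quad_form_smult_mat:
  assumes "A \<in> carrier_mat n n" and "x \<in> carrier_vec n"
  shows "quad_form (c \<cdot>\<^sub>m A) x = c * quad_form A x"
proof -
  have "(c \<cdot>\<^sub>m A) *\<^sub>v x = c \<cdot>\<^sub>v (A *\<^sub>v x)" using assms by (intro eq_vecI) auto
  then show ?thesis using assms by (simp add: quad_form_def)
qed

lemma quad_form_uminus_mat:
  assumes "A \<in> carrier_mat n n" and "x \<in> carrier_vec n"
  shows "quad_form (- A) x = - quad_form A x"
  using assms by (simp add: quad_form_def)

lemma quad_form_congruence:
  assumes A: "A \<in> carrier_mat m m" and S: "S \<in> carrier_mat m n" and x: "x \<in> carrier_vec n"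
  shows "quad_form (transpose_mat S * A * S) x = quad_form A (S *\<^sub>v x)"
proof -
  have "transpose_mat S * A * S *\<^sub>v x = transpose_mat S * A *\<^sub>v (S *\<^sub>v x)"
    using A S x by (intro assoc_mult_mat_vec[of _ n m _ n]) auto
  also have "\<dots> = transpose_mat S *\<^sub>v (A *\<^sub>v (S *\<^sub>v x))"
    using A S x by (intro assoc_mult_mat_vec[of _ n m _ m]) auto
  finally have "x \<bullet> (transpose_mat S * A * S *\<^sub>v x) = x \<bullet> (transpose_mat S *\<^sub>v (A *\<^sub>v (S *\<^sub>v x)))"
    by simp
  also have "\<dots> = (transpose_mat S *\<^sub>v (A *\<^sub>v (S *\<^sub>v x))) \<bullet> x"
    using A S x by (intro comm_scalar_prod[of _ n]) auto
  also have "\<dots> = (A *\<^sub>v (S *\<^sub>v x)) \<bullet> (S *\<^sub>v x)"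
    using A S x by (intro transpose_vec_mult_scalar[of _ m n]) auto
  also have "\<dots> = (S *\<^sub>v x) \<bullet> (A *\<^sub>v (S *\<^sub>v x))"
    using A S x by (intro comm_scalar_prod[of _ m]) auto
  finally show ?thesis by (simp add: quad_form_def)
qed

lemma sym_mat_congruence:
  assumes A: "A \<in> sym_mat m" and S: "S \<in> carrier_mat m n"
  shows "transpose_mat S * A * S \<in> sym_mat n"
proof -
  have Ac: "A \<in> carrier_mat m m" and At: "transpose_mat A = A" using A by (auto simp: sym_mat_def)
  have "transpose_mat (transpose_mat S * A * S) = transpose_mat S * transpose_mat (transpose_mat S * A)"
    using Ac S by (intro transpose_mult[of _ n m _ n]) auto
  also have "transpose_mat (transpose_mat S * A) = transpose_mat A * transpose_mat (transpose_mat S)"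
    using Ac S by (intro transpose_mult[of _ n m _ m]) auto
  also have "transpose_mat S * \<dots> = transpose_mat S * A * S"
    unfolding At transpose_transpose using Ac S by (intro assoc_mult_mat[symmetric, of _ n m _ m _ n]) auto
  finally show ?thesis using Ac S by (simp add: sym_mat_def)
qed

lemma sym_mat_minus: "A \<in> sym_mat n \<Longrightarrow> B \<in> sym_mat n \<Longrightarrow> A - B \<in> sym_mat n"
  by (auto simp: sym_mat_def transpose_minus)

lemma sym_mat_smult:
  assumes "A \<in> sym_mat n"
  shows "c \<cdot>\<^sub>m A \<in> sym_mat n"
proof -
  have "transpose_mat (c \<cdot>\<^sub>m A) = c \<cdot>\<^sub>m transpose_mat A" by (intro eq_matI) auto
  then show ?thesis using assms by (simp add: sym_mat_def)
qed

lemma quad_form_four_block: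
  assumes "A \<in> carrier_mat a a" "B \<in> carrier_mat a b" "C \<in> carrier_mat b a" "D \<in> carrier_mat b b"
    and "x \<in> carrier_vec a" "y \<in> carrier_vec b"
  shows "quad_form (four_block_mat A B C D) (x @\<^sub>v y) =
    quad_form A x + x \<bullet> (B *\<^sub>v y) + y \<bullet> (C *\<^sub>v x) + quad_form D y"
  using assms unfolding quad_form_def
  by (simp add: four_block_mat_mult_vec scalar_prod_append[of _ a _ b] scalar_prod_add_distrib[of _ a]
      scalar_prod_add_distrib[of _ b])

lemma sym_four_blockI:
  assumes "A \<in> sym_mat a" "B \<in> carrier_mat a b" "D \<in> sym_mat b"
  shows "four_block_mat A B (transpose_mat B) D \<in> sym_mat (a + b)"
  using assms by (auto simp: sym_mat_def transpose_four_block_mat[of _ a a _ b _ b])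

lemma sym_mat_four_block:
  assumes "N \<in> sym_mat (a + b)"
  obtains A B D where "A \<in> sym_mat a" "B \<in> carrier_mat a b" "D \<in> sym_mat b"
    "N = four_block_mat A B (transpose_mat B) D"
proof -
  have N: "N \<in> carrier_mat (a + b) (a + b)" and Nt: "transpose_mat N = N"
    using assms by (auto simp: sym_mat_def)
  have entry: "N $$ (i, j) = N $$ (j, i)" if "i < a + b" "j < a + b" for i j
    using that N arg_cong[OF Nt, of "\<lambda>M. M $$ (i, j)"] by simp
  let ?A = "mat a a (\<lambda>(i, j). N $$ (i, j))" and ?B = "mat a b (\<lambda>(i, j). N $$ (i, j + a))"
    and ?D = "mat b b (\<lambda>(i, j). N $$ (i + a, j + a))"
  have "?A \<in> sym_mat a" "?D \<in> sym_mat b"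
    by (auto simp: sym_mat_def intro!: eq_matI entry)
  moreover have "N = four_block_mat ?A ?B (transpose_mat ?B) ?D"
    using N by (intro eq_matI) (auto intro: entry)
  ultimately show ?thesis by (intro that[of ?A ?B ?D]) auto
qed

text \<open>The Cauchy--Schwarz inequality for a possibly degenerate form: it is the nonnegativity of
  the form at the combination of \<open>u\<close> and \<open>v\<close> that is orthogonal to \<open>u\<close>.\<close>

lemma semidefinite_Cauchy_Schwarz:
  assumes S: "S \<in> sym_mat n" and psd: "\<And>x. x \<in> carrier_vec n \<Longrightarrow> quad_form S x \<ge> 0"
    and u: "u \<in> carrier_vec n" and v: "v \<in> carrier_vec n" and pos: "quad_form S u > 0"
  shows "(u \<bullet> (S *\<^sub>v v))\<^sup>2 \<le> quad_form S u * quad_form S v"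
proof -
  let ?s = "quad_form S u" and ?t = "u \<bullet> (S *\<^sub>v v)"
  have "0 \<le> quad_form S ((- ?t) \<cdot>\<^sub>v u + ?s \<cdot>\<^sub>v v)" using u v by (intro psd) auto
  also have "\<dots> = ?s * (?s * quad_form S v - ?t\<^sup>2)"
    unfolding quad_form_lincomb[OF S u v] by (simp add: algebra_simps power2_eq_square)
  finally show ?thesis using pos by (simp add: zero_le_mult_iff)
qed

section \<open>The strict S-lemma\<close>

text \<open>Bolzano--Weierstrass for the unit cube, one coordinate at a time. The dimension is an
  ordinary number here, not a type.\<close>

lemma coordinatewise_convergent_subsequence:
  fixes z :: "nat \<Rightarrow> nat \<Rightarrow> real"
  assumes "\<And>k i. i < n \<Longrightarrow> \<bar>z k i\<bar> \<le> 1"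
  shows "\<exists>r l. strict_mono (r :: nat \<Rightarrow> nat) \<and> (\<forall>i<n. (\<lambda>k. z (r k) i) \<longlonglongrightarrow> l i)"
  using assms
proof (induction n)
  case 0
  have "strict_mono (\<lambda>k::nat. k)" by (simp add: strict_mono_def)
  then show ?case by blast
next
  case (Suc n)
  then obtain r l where r: "strict_mono r" and l: "\<And>i. i < n \<Longrightarrow> (\<lambda>k. z (r k) i) \<longlonglongrightarrow> l i"
    by (metis less_Suc_eq)
  obtain s where s: "strict_mono s" and mono: "monoseq (\<lambda>k. z (r (s k)) n)"
    using seq_monosub[of "\<lambda>k. z (r k) n"] by blast
  have "Bseq (\<lambda>k. z (r (s k)) n)" using Suc.prems by (intro BseqI'[of _ 1]) auto
  then obtain a where a: "(\<lambda>k. z (r (s k)) n) \<longlonglongrightarrow> a"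
    using mono Bseq_monoseq_convergent by (auto simp: convergent_def)
  have "(\<lambda>k. z ((r \<circ> s) k) i) \<longlonglongrightarrow> (l(n := a)) i" if "i < Suc n" for i
  proof (cases "i = n")
    case False
    then have "((\<lambda>k. z (r k) i) \<circ> s) \<longlonglongrightarrow> l i"
      using that l[of i] s by (intro LIMSEQ_subseq_LIMSEQ) auto
    then show ?thesis using False by (simp add: o_def)
  qed (use a in simp)
  moreover have "strict_mono (r \<circ> s)" using r s by (simp add: strict_mono_def)
  ultimately show ?case by blast
qed

lemma quad_form_tendsto:
  assumes A: "A \<in> carrier_mat n n" and z: "\<And>k. z k \<in> carrier_vec n" and l: "l \<in> carrier_vec n"
    and lim: "\<And>i. i < n \<Longrightarrow> (\<lambda>k. z k $ i) \<longlonglongrightarrow> l $ i"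
  shows "(\<lambda>k. quad_form A (z k)) \<longlonglongrightarrow> quad_form A l"
proof -
  have expand: "quad_form A x = (\<Sum>i\<in>{0..<n}. x $ i * (\<Sum>j\<in>{0..<n}. A $$ (i, j) * x $ j))"
    if "x \<in> carrier_vec n" for x
    using that A by (auto simp: quad_form_def scalar_prod_def intro!: sum.cong)
  show ?thesis unfolding expand[OF z] expand[OF l] by (intro tendsto_intros lim) auto
qed

lemma quad_form_one: "x \<in> carrier_vec n \<Longrightarrow> quad_form (1\<^sub>m n) x = (\<Sum>i<n. (x $ i)\<^sup>2)"
  by (simp add: quad_form_def scalar_prod_def power2_eq_square atLeast0LessThan)

text \<open>Closedness comes from compactness of the unit sphere: unit vectors that witness the
  conditions for \<open>t\<^sub>k \<longlonglongrightarrow> t\<close> have a limit point, which witnesses them for \<open>t\<close>.\<close>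

lemma closed_pencil_witness:
  assumes A: "A \<in> carrier_mat n n" and B: "B \<in> carrier_mat n n" and D: "D \<in> carrier_mat n n"
  shows "closed {t. \<exists>z \<in> carrier_vec n. quad_form (1\<^sub>m n) z = 1 \<and>
    t * quad_form A z \<le> (1 - t) * quad_form B z \<and> quad_form D z \<le> 0}"
  unfolding closed_sequential_limits
proof (intro allI impI, elim conjE)
  fix t :: "nat \<Rightarrow> real" and t'
  assume "\<forall>k. t k \<in> {t. \<exists>z \<in> carrier_vec n. quad_form (1\<^sub>m n) z = 1 \<and>
    t * quad_form A z \<le> (1 - t) * quad_form B z \<and> quad_form D z \<le> 0}"
  then have "\<forall>k. \<exists>z. z \<in> carrier_vec n \<and> quad_form (1\<^sub>m n) z = 1 \<and>
    t k * quad_form A z \<le> (1 - t k) * quad_form B z \<and> quad_form D z \<le> 0" by blast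
  then obtain z where z: "\<And>k. z k \<in> carrier_vec n" and unit: "\<And>k. quad_form (1\<^sub>m n) (z k) = 1"
    and AB: "\<And>k. t k * quad_form A (z k) \<le> (1 - t k) * quad_form B (z k)"
    and Dz: "\<And>k. quad_form D (z k) \<le> 0" by metis
  assume t: "t \<longlonglongrightarrow> t'"
  have "\<bar>z k $ i\<bar> \<le> 1" if "i < n" for k i
  proof -
    have "(z k $ i)\<^sup>2 \<le> (\<Sum>i<n. (z k $ i)\<^sup>2)"
      using that by (intro member_le_sum) auto
    also have "\<dots> = 1" using unit[of k] quad_form_one[OF z] by simp
    finally show ?thesis by (simp add: abs_square_le_1)
  qed
  then obtain r l0 where r: "strict_mono (r :: nat \<Rightarrow> nat)"
    and l0: "\<And>i. i < n \<Longrightarrow> (\<lambda>k. z (r k) $ i) \<longlonglongrightarrow> l0 i"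
    using coordinatewise_convergent_subsequence[of n "\<lambda>k i. z k $ i"] by blast
  define l where "l = vec n l0"
  have l: "l \<in> carrier_vec n" by (simp add: l_def)
  have lim: "(\<lambda>k. quad_form M (z (r k))) \<longlonglongrightarrow> quad_form M l" if "M \<in> carrier_mat n n" for M
    using that z l l0 by (intro quad_form_tendsto) (auto simp: l_def)
  have tr: "(\<lambda>k. t (r k)) \<longlonglongrightarrow> t'" using LIMSEQ_subseq_LIMSEQ[OF t r] by (simp add: o_def)
  have "quad_form (1\<^sub>m n) l = 1"
    using lim[of "1\<^sub>m n"] by (simp add: unit LIMSEQ_const_iff)
  moreover have "t' * quad_form A l \<le> (1 - t') * quad_form B l"
    by (rule LIMSEQ_le[of "\<lambda>k. t (r k) * quad_form A (z (r k))" _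
          "\<lambda>k. (1 - t (r k)) * quad_form B (z (r k))"])
      (use AB in \<open>auto intro!: tendsto_intros tr lim A B\<close>)
  moreover have "quad_form D l \<le> 0"
    by (rule LIMSEQ_le_const2[OF lim[OF D]]) (use Dz in auto)
  ultimately show "t' \<in> {t. \<exists>z \<in> carrier_vec n. quad_form (1\<^sub>m n) z = 1 \<and>
    t * quad_form A z \<le> (1 - t) * quad_form B z \<and> quad_form D z \<le> 0}" using l by blast
qed

lemma closed_cover_unit_interval_meet:
  assumes "closed S" and "closed T" and "{0..1::real} \<subseteq> S \<union> T" and "0 \<in> S" and "1 \<in> T"
  shows "\<exists>t \<in> {0..1}. t \<in> S \<and> t \<in> T"
proof (rule ccontr)
  assume "\<not> ?thesis"
  then have "S \<inter> T \<inter> {0..1} = {}" by blast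
  then have "S \<inter> {0..1} = {} \<or> T \<inter> {0..1} = {}"
    using assms by (intro connected_closedD[OF connected_Icc]) auto
  then show False using assms by auto
qed

lemma normalize_quad_form:
  assumes z: "z \<in> carrier_vec n" and nz: "z \<noteq> 0\<^sub>v n"
  shows "\<exists>c. c \<noteq> 0 \<and> quad_form (1\<^sub>m n) (c \<cdot>\<^sub>v z) = 1"
proof -
  obtain i where i: "i < n" "z $ i \<noteq> 0" using z nz by (metis carrier_vecD eq_vecI index_zero_vec)
  have "0 < (z $ i)\<^sup>2" using i by simp
  also have "\<dots> \<le> (\<Sum>i<n. (z $ i)\<^sup>2)" using i by (intro member_le_sum) auto
  also have "\<dots> = quad_form (1\<^sub>m n) z" using quad_form_one[OF z] by simp
  finally have "quad_form (1\<^sub>m n) z > 0" .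
  then have "1 / sqrt (quad_form (1\<^sub>m n) z) \<noteq> 0"
    "quad_form (1\<^sub>m n) ((1 / sqrt (quad_form (1\<^sub>m n) z)) \<cdot>\<^sub>v z) = 1"
    using z by (auto simp: quad_form_smult[of _ n] power_divide)
  then show ?thesis by blast
qed

text \<open>The proof follows Yuan. If no \<open>\<beta>\<close> works, every pencil member \<open>t A - (1 - t) B\<close> with
  \<open>0 < t < 1\<close> is nonpositive at some unit vector, at which necessarily \<open>A \<le> 0\<close> or \<open>B \<ge> 0\<close>. The two
  sets of parameters \<open>t\<close> that arise in this way are closed and, by taking limits, cover \<open>[0, 1]\<close>;
  the endpoints lie in different ones, so by connectedness some \<open>t\<close> lies in both. This \<open>t\<close> has two
  witnesses \<open>x\<close> and \<open>y\<close>, one with \<open>A \<le> 0\<close> and one with \<open>B \<ge> 0\<close>. After a change of sign the pencil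
  member is nonpositive on the whole segment from \<open>x\<close> to \<open>y\<close>, so at each of its points \<open>A \<le> 0\<close> or
  \<open>B \<ge> 0\<close>, and a second use of connectedness gives a nonzero point where both hold. Working with
  open parameters \<open>t\<close> only is what makes \<open>\<beta> = t / (1 - t)\<close> positive and finite.\<close>

lemma strict_S_lemma:
  assumes A: "A \<in> sym_mat n" and B: "B \<in> sym_mat n"
    and imp: "\<And>z. z \<in> carrier_vec n \<Longrightarrow> z \<noteq> 0\<^sub>v n \<Longrightarrow> quad_form B z \<ge> 0 \<Longrightarrow> quad_form A z > 0"
  shows "\<exists>\<beta>>0. \<forall>z \<in> carrier_vec n. z \<noteq> 0\<^sub>v n \<longrightarrow> \<beta> * quad_form A z > quad_form B z"
proof (rule ccontr)
  assume contra: "\<not> ?thesis"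
  note Ac = sym_mat_carrier[OF A] and Bc = sym_mat_carrier[OF B]
  \<comment> \<open>The parameters for which the pencil member is nonpositive at a unit vector where \<open>D \<le> 0\<close>;
    only \<open>D = A\<close> and \<open>D = - B\<close> matter.\<close>
  define W where "W D = {t. \<exists>z \<in> carrier_vec n. quad_form (1\<^sub>m n) z = 1 \<and>
    t * quad_form A z \<le> (1 - t) * quad_form B z \<and> quad_form D z \<le> 0}" for D
  have closed: "closed (W A)" "closed (W (- B))"
    unfolding W_def using Ac Bc by (intro closed_pencil_witness; simp)+
  have nonzero: "z \<noteq> 0\<^sub>v n" if "quad_form (1\<^sub>m n) z = 1" for z
    using that by auto
  have "{0<..<1} \<subseteq> W A \<union> W (- B)"
  proof
    fix t :: real assume "t \<in> {0<..<1}"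
    then have t: "0 < t" "t < 1" by auto
    have "t / (1 - t) > 0" using t by simp
    then obtain z where z: "z \<in> carrier_vec n" "z \<noteq> 0\<^sub>v n"
      and le: "t / (1 - t) * quad_form A z \<le> quad_form B z"
      using contra by (meson not_less)
    obtain c where c: "c \<noteq> 0" "quad_form (1\<^sub>m n) (c \<cdot>\<^sub>v z) = 1"
      using normalize_quad_form[OF z] by blast
    have le': "t * quad_form A z \<le> (1 - t) * quad_form B z"
      using le t by (simp add: field_simps)
    have scaled: "t * quad_form A (c \<cdot>\<^sub>v z) \<le> (1 - t) * quad_form B (c \<cdot>\<^sub>v z)"
      using mult_left_mono[OF le', of "c\<^sup>2"] z Ac Bc by (simp add: quad_form_smult algebra_simps)
    moreover have "quad_form A (c \<cdot>\<^sub>v z) \<le> 0 \<or> quad_form (- B) (c \<cdot>\<^sub>v z) \<le> 0"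
    proof (rule ccontr)
      assume "\<not> ?thesis"
      then have "quad_form A (c \<cdot>\<^sub>v z) > 0" "quad_form B (c \<cdot>\<^sub>v z) < 0"
        using z Bc by (auto simp: quad_form_uminus_mat)
      then have "t * quad_form A (c \<cdot>\<^sub>v z) > 0" "(1 - t) * quad_form B (c \<cdot>\<^sub>v z) < 0"
        using t by (auto simp: mult_pos_neg)
      then show False using scaled by linarith
    qed
    moreover have "c \<cdot>\<^sub>v z \<in> carrier_vec n" using z by simp
    ultimately show "t \<in> W A \<union> W (- B)" using c(2) scaled unfolding W_def by blast
  qed
  then have "closure {0<..<1} \<subseteq> W A \<union> W (- B)"
    using closed by (intro closure_minimal closed_Un)
  then have cover: "{0..1} \<subseteq> W A \<union> W (- B)" by simp
  have "0 \<in> W (- B)" "1 \<in> W A"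
  proof -
    have "0 \<in> W A \<union> W (- B)" "1 \<in> W A \<union> W (- B)"
      using subsetD[OF cover, of 0] subsetD[OF cover, of 1] by simp_all
    then show "0 \<in> W (- B)" "1 \<in> W A"
      using Bc by (auto simp: W_def quad_form_uminus_mat)
  qed
  then obtain t where t: "t \<in> {0..1}" "t \<in> W A" "t \<in> W (- B)"
    using closed_cover_unit_interval_meet[of "W (- B)" "W A"] closed cover by blast
  define h where "h z = t * quad_form A z - (1 - t) * quad_form B z" for z
  obtain x where x: "x \<in> carrier_vec n" "x \<noteq> 0\<^sub>v n" "h x \<le> 0" "quad_form A x \<le> 0"
    using t(2) nonzero unfolding W_def h_def by force
  obtain y0 where y0: "y0 \<in> carrier_vec n" "y0 \<noteq> 0\<^sub>v n" "h y0 \<le> 0" "quad_form B y0 \<ge> 0"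
    using t(3) nonzero Bc unfolding W_def h_def by (force simp: quad_form_uminus_mat)
  define k where "k y = t * (x \<bullet> (A *\<^sub>v y)) - (1 - t) * (x \<bullet> (B *\<^sub>v y))" for y
  \<comment> \<open>Replacing \<open>y0\<close> by \<open>- y0\<close> if necessary, the mixed term of the pencil is nonpositive.\<close>
  obtain y where y: "y \<in> carrier_vec n" "y \<noteq> 0\<^sub>v n" "h y \<le> 0" "quad_form B y \<ge> 0" "k y \<le> 0"
  proof (cases "k y0 \<le> 0")
    case False
    have "quad_form A ((-1) \<cdot>\<^sub>v y0) = quad_form A y0" "quad_form B ((-1) \<cdot>\<^sub>v y0) = quad_form B y0"
      using y0 Ac Bc by (simp_all only: quad_form_smult) simp_all
    moreover have "k ((-1) \<cdot>\<^sub>v y0) = - k y0"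
    proof -
      have "A *\<^sub>v ((-1) \<cdot>\<^sub>v y0) = (-1) \<cdot>\<^sub>v (A *\<^sub>v y0)" "B *\<^sub>v ((-1) \<cdot>\<^sub>v y0) = (-1) \<cdot>\<^sub>v (B *\<^sub>v y0)"
        using y0 Ac Bc by (simp_all only: mult_mat_vec)
      then show ?thesis using x y0 Ac Bc unfolding k_def by (simp add: algebra_simps)
    qed
    moreover have "(-1) \<cdot>\<^sub>v y0 \<noteq> 0\<^sub>v n"
    proof
      assume eq: "(-1) \<cdot>\<^sub>v y0 = 0\<^sub>v n"
      have "y0 = (-1) \<cdot>\<^sub>v ((-1) \<cdot>\<^sub>v y0)" by (simp add: smult_smult_assoc)
      also have "\<dots> = 0\<^sub>v n" unfolding eq by auto
      finally show False using y0 by simp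
    qed
    ultimately show ?thesis using False y0 by (intro that[of "(-1) \<cdot>\<^sub>v y0"]) (auto simp: h_def)
  qed (use that y0 in blast)
  define z where "z s = (1 - s) \<cdot>\<^sub>v x + s \<cdot>\<^sub>v y" for s
  have zc: "z s \<in> carrier_vec n" for s using x y by (simp add: z_def)
  have qz: "quad_form M (z s) = (1 - s)\<^sup>2 * quad_form M x + 2 * (1 - s) * s * (x \<bullet> (M *\<^sub>v y)) + s\<^sup>2 * quad_form M y"
    if "M \<in> sym_mat n" for M s unfolding z_def using quad_form_lincomb[OF that x(1) y(1)] .
  have znz: "z s \<noteq> 0\<^sub>v n" if s: "s \<in> {0..1}" for s
  proof
    assume z0: "z s = 0\<^sub>v n"
    have "(1 - s) \<cdot>\<^sub>v x = (- s) \<cdot>\<^sub>v y"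
    proof (rule eq_vecI)
      fix i assume "i < dim_vec ((- s) \<cdot>\<^sub>v y)"
      then have i: "i < n" using y by simp
      have "z s $ i = 0" using z0 i by simp
      then show "((1 - s) \<cdot>\<^sub>v x) $ i = ((- s) \<cdot>\<^sub>v y) $ i"
        using i x y by (simp add: z_def)
    qed (use x y in simp)
    then have "quad_form B ((1 - s) \<cdot>\<^sub>v x) = quad_form B ((- s) \<cdot>\<^sub>v y)" by simp
    \<comment> \<open>A segment through the origin would make \<open>B x\<close> and \<open>B y\<close> have the same sign.\<close>
    then have eq: "(1 - s)\<^sup>2 * quad_form B x = s\<^sup>2 * quad_form B y"
      using x y Bc by (simp add: quad_form_smult)
    have "quad_form B x < 0" using imp[of x] x by force
    moreover have "s\<^sup>2 * quad_form B y \<ge> 0" using y by simp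
    ultimately have "s = 1" using eq
      by (smt (verit) mult_pos_neg zero_eq_power2 zero_le_power2)
    then have "z s = y" using x y by (intro eq_vecI) (auto simp: z_def)
    then show False using z0 y by simp
  qed
  have hz: "h (z s) \<le> 0" if s: "s \<in> {0..1}" for s
  proof -
    have "h (z s) = (1 - s)\<^sup>2 * h x + 2 * ((1 - s) * s) * k y + s\<^sup>2 * h y"
      unfolding h_def k_def qz[OF A] qz[OF B] by (simp add: algebra_simps)
    moreover have "(1 - s)\<^sup>2 * h x \<le> 0" "s\<^sup>2 * h y \<le> 0"
      using x(3) y(3) by (simp_all add: mult_nonneg_nonpos)
    moreover have "2 * ((1 - s) * s) * k y \<le> 0"
      using s y(5) by (intro mult_nonneg_nonpos) auto
    ultimately show ?thesis by linarith
  qed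
  have one_sign: "quad_form A (z s) \<le> 0 \<or> quad_form B (z s) \<ge> 0" if s: "s \<in> {0..1}" for s
  proof (rule ccontr)
    assume "\<not> ?thesis"
    then have ab: "quad_form A (z s) > 0" "quad_form B (z s) < 0" by auto
    have t01: "0 \<le> t" "t \<le> 1" using t(1) by auto
    have "h (z s) > 0"
    proof (cases "t = 0")
      case False
      then have "t * quad_form A (z s) > 0" using t01 ab by simp
      moreover have "(1 - t) * quad_form B (z s) \<le> 0"
        using t01 ab by (intro mult_nonneg_nonpos) auto
      ultimately show ?thesis unfolding h_def by linarith
    qed (use ab in \<open>simp add: h_def\<close>)
    then show False using hz[OF s] by simp
  qed
  have "closed {s. quad_form A (z s) \<le> 0}" "closed {s. quad_form B (z s) \<ge> 0}"
    unfolding qz[OF A] qz[OF B] by (intro closed_Collect_le continuous_intros)+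
  moreover have "z 0 = x" "z 1 = y" using x y by (auto simp: z_def)
  moreover have "{0..1} \<subseteq> {s. quad_form A (z s) \<le> 0} \<union> {s. quad_form B (z s) \<ge> 0}"
    using one_sign by blast
  ultimately have "\<exists>s \<in> {0..1}. s \<in> {s. quad_form A (z s) \<le> 0} \<and> s \<in> {s. quad_form B (z s) \<ge> 0}"
    using x(4) y(4) by (intro closed_cover_unit_interval_meet) simp_all
  then obtain s where "s \<in> {0..1}" "quad_form A (z s) \<le> 0" "quad_form B (z s) \<ge> 0" by blast
  then show False using imp[OF zc znz] by force
qed

section \<open>Definite matrices and their inverses\<close>

lemma pos_def_mat_inverse:
  assumes pd: "pos_def n A"
  obtains B where "mat_inverse A = Some B" "pos_def n B" "A * B = 1\<^sub>m n" "B * A = 1\<^sub>m n"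
proof -
  have As: "A \<in> sym_mat n" and pos: "\<And>x. x \<in> carrier_vec n \<Longrightarrow> x \<noteq> 0\<^sub>v n \<Longrightarrow> quad_form A x > 0"
    using pd by (auto simp: pos_def_iff_quad_form)
  have A: "A \<in> carrier_mat n n" and At: "transpose_mat A = A" using As by (auto simp: sym_mat_def)
  have "det A \<noteq> 0"
  proof
    assume "det A = 0"
    then obtain v where v: "v \<in> carrier_vec n" "v \<noteq> 0\<^sub>v n" "A *\<^sub>v v = 0\<^sub>v n"
      using det_0_iff_vec_prod_zero_field[OF A] by blast
    then have "quad_form A v = 0" by (simp add: quad_form_def)
    then show False using pos v by force
  qed
  then have "A \<in> Units (ring_mat TYPE(real) n ())" by (rule det_non_zero_imp_unit[OF A])
  then obtain B where inv: "mat_inverse A = Some B" using mat_inverse(1)[OF A] by fastforce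
  then have AB: "A * B = 1\<^sub>m n" and BA: "B * A = 1\<^sub>m n" and B: "B \<in> carrier_mat n n"
    using mat_inverse(2)[OF A] by auto
  have "transpose_mat B = transpose_mat B * (A * B)" using B AB by simp
  also have "\<dots> = transpose_mat B * A * B"
    using A B by (intro assoc_mult_mat[symmetric, of _ n n _ n _ n]) auto
  also have "transpose_mat B * A = transpose_mat (A * B)"
    using A B At by (simp add: transpose_mult[of _ n n _ n])
  finally have Bs: "B \<in> sym_mat n" using B AB by (simp add: sym_mat_def)
  have "quad_form B x > 0" if x: "x \<in> carrier_vec n" "x \<noteq> 0\<^sub>v n" for x
  proof -
    have xAB: "A *\<^sub>v (B *\<^sub>v x) = x"
      using x A B AB by (simp add: assoc_mult_mat_vec[symmetric, of _ n n _ n])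
    have "B *\<^sub>v x \<noteq> 0\<^sub>v n" using xAB x A by auto
    then have "0 < quad_form A (B *\<^sub>v x)" using pos B x by simp
    also have "\<dots> = quad_form B x"
      using B x unfolding quad_form_def xAB by (intro comm_scalar_prod[of _ n]) auto
    finally show ?thesis .
  qed
  then have "pos_def n B" using Bs by (simp add: pos_def_iff_quad_form)
  then show ?thesis using inv AB BA by (intro that)
qed

text \<open>This is the equivalence of \<open>A - C A C\<^sup>T > 0\<close> and \<open>B - C\<^sup>T B C > 0\<close> for \<open>B = A\<inverse>\<close>, usually read off
  from the two Schur complements of one block matrix. A direct argument: for \<open>a = B C z\<close> and
  \<open>b = C\<^sup>T a\<close> both \<open>a\<^sup>T A a\<close> and \<open>b\<^sup>T z\<close> equal \<open>q = (C z)\<^sup>T B (C z)\<close>, so \<open>b\<^sup>T A b < q\<close> and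
  \<open>0 \<le> (A b - z)\<^sup>T B (A b - z) = b\<^sup>T A b - 2 q + z\<^sup>T B z < z\<^sup>T B z - q\<close>.\<close>

lemma contraction_inverse_form:
  assumes A: "A \<in> sym_mat n" and B: "pos_def n B"
    and AB: "A * B = 1\<^sub>m n" and BA: "B * A = 1\<^sub>m n" and C: "C \<in> carrier_mat n n"
    and contr: "\<And>x. x \<in> carrier_vec n \<Longrightarrow> x \<noteq> 0\<^sub>v n \<Longrightarrow>
      quad_form A (transpose_mat C *\<^sub>v x) < quad_form A x"
    and z: "z \<in> carrier_vec n" "z \<noteq> 0\<^sub>v n"
  shows "quad_form B (C *\<^sub>v z) < quad_form B z"
proof (cases "C *\<^sub>v z = 0\<^sub>v n")
  case True
  then show ?thesis using B z by (auto simp: pos_def_iff_quad_form dest: sym_mat_carrier)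
next
  case False
  have Bs: "B \<in> sym_mat n" using B by (simp add: pos_def_def)
  note Ac = sym_mat_carrier[OF A] and Bc = sym_mat_carrier[OF Bs]
  have psd: "quad_form B x \<ge> 0" if "x \<in> carrier_vec n" for x
    using B that by (cases "x = 0\<^sub>v n") (auto simp: pos_def_iff_quad_form Bc less_imp_le)
  have cancelA: "A *\<^sub>v (B *\<^sub>v x) = x" and cancelB: "B *\<^sub>v (A *\<^sub>v x) = x" if "x \<in> carrier_vec n" for x
    using that Ac Bc AB BA by (simp_all add: assoc_mult_mat_vec[symmetric, of _ n n _ n])
  let ?q = "quad_form B (C *\<^sub>v z)"
  define a where "a = B *\<^sub>v (C *\<^sub>v z)"
  define b where "b = transpose_mat C *\<^sub>v a"
  have Cz: "C *\<^sub>v z \<in> carrier_vec n" and a: "a \<in> carrier_vec n" and b: "b \<in> carrier_vec n"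
    using C z Bc by (auto simp: a_def b_def)
  have Aa: "A *\<^sub>v a = C *\<^sub>v z" unfolding a_def by (rule cancelA[OF Cz])
  have aCz: "a \<bullet> (C *\<^sub>v z) = ?q"
    unfolding quad_form_def a_def[symmetric] by (rule comm_scalar_prod[OF a Cz])
  have "a \<noteq> 0\<^sub>v n" using Aa False Ac by auto
  then have "quad_form A b < quad_form A a" unfolding b_def by (rule contr[OF a])
  also have "quad_form A a = ?q" using aCz by (simp add: quad_form_def Aa)
  finally have less: "quad_form A b < ?q" .
  have Ab: "A *\<^sub>v b \<in> carrier_vec n" using Ac b by simp
  have qAb: "quad_form B (A *\<^sub>v b) = quad_form A b"
    unfolding quad_form_def cancelB[OF b] by (rule comm_scalar_prod[OF Ab b])
  have "(A *\<^sub>v b) \<bullet> (B *\<^sub>v z) = z \<bullet> (B *\<^sub>v (A *\<^sub>v b))"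
    by (rule sym_mat_bilinear_commute[OF Bs Ab z(1)])
  also have "\<dots> = b \<bullet> z" unfolding cancelB[OF b] by (rule comm_scalar_prod[OF z(1) b])
  also have "\<dots> = ?q"
    unfolding b_def using transpose_vec_mult_scalar[OF C z(1) a] aCz by simp
  finally have mixed: "(A *\<^sub>v b) \<bullet> (B *\<^sub>v z) = ?q" .
  have "0 \<le> quad_form B (1 \<cdot>\<^sub>v (A *\<^sub>v b) + (-1) \<cdot>\<^sub>v z)" using Ab z by (intro psd) auto
  also have "\<dots> = quad_form A b - 2 * ?q + quad_form B z"
    unfolding quad_form_lincomb[OF Bs Ab z(1)] by (simp add: qAb mixed)
  finally show ?thesis using less by simp
qed

section \<open>Interpolation by solutions of a quadratic matrix inequality\<close>

text \<open>Let \<open>- K < 0\<close> be the lower right block of \<open>N\<close> and \<open>S\<close> its Schur complement. Completing the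
  square gives \<open>N(v, X v + z) = v\<^sup>T S v - z\<^sup>T K z\<close> for a fixed matrix \<open>X\<close>, so the solutions are the
  matrices \<open>P\<^sup>T = X + Z\<close> with \<open>Z\<^sup>T K Z \<le> S\<close>. The existence of one solution gives \<open>S \<ge> 0\<close>. The
  required \<open>z = Z u\<close> satisfies \<open>z\<^sup>T K z \<le> u\<^sup>T S u\<close>, and the rank one matrix
  \<open>Z = z (S u)\<^sup>T / (u\<^sup>T S u)\<close> meets the bound by the Cauchy--Schwarz inequality. If \<open>u\<^sup>T S u = 0\<close>,
  then \<open>z = 0\<close> and \<open>Z = 0\<close> will do.\<close>

lemma quadratic_matrix_inequality_interpolation:
  assumes N: "N \<in> sym_mat (p + n)"
    and neg: "\<And>w. w \<in> carrier_vec n \<Longrightarrow> w \<noteq> 0\<^sub>v n \<Longrightarrow> quad_form N (0\<^sub>v p @\<^sub>v w) < 0"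
    and P0: "P0 \<in> carrier_mat p n"
      "\<And>v. v \<in> carrier_vec p \<Longrightarrow> quad_form N (v @\<^sub>v (transpose_mat P0 *\<^sub>v v)) \<ge> 0"
    and u: "u \<in> carrier_vec p" and w: "w \<in> carrier_vec n" and uw: "quad_form N (u @\<^sub>v w) \<ge> 0"
  shows "\<exists>P \<in> carrier_mat p n. transpose_mat P *\<^sub>v u = w \<and>
    (\<forall>v \<in> carrier_vec p. quad_form N (v @\<^sub>v (transpose_mat P *\<^sub>v v)) \<ge> 0)"
proof -
  obtain A B D where As: "A \<in> sym_mat p" and B: "B \<in> carrier_mat p n" and Ds: "D \<in> sym_mat n"
    and N_eq: "N = four_block_mat A B (transpose_mat B) D" by (rule sym_mat_four_block[OF N])
  note A = sym_mat_carrier[OF As] and D = sym_mat_carrier[OF Ds]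
  have qN: "quad_form N (v @\<^sub>v z) = quad_form A v + 2 * (v \<bullet> (B *\<^sub>v z)) + quad_form D z"
    if v: "v \<in> carrier_vec p" and z: "z \<in> carrier_vec n" for v z
  proof -
    have "z \<bullet> (transpose_mat B *\<^sub>v v) = (transpose_mat B *\<^sub>v v) \<bullet> z"
      using B v z by (intro comm_scalar_prod[of _ n]) auto
    also have "\<dots> = v \<bullet> (B *\<^sub>v z)" by (rule transpose_vec_mult_scalar[OF B z v])
    finally show ?thesis
      unfolding N_eq using quad_form_four_block[OF A B _ D v z, of "transpose_mat B"] B by simp
  qed
  define K where "K = - D"
  have Ks: "K \<in> sym_mat n" using Ds by (auto simp: K_def sym_mat_def transpose_uminus)
  note K = sym_mat_carrier[OF Ks]
  have qD: "quad_form D z = - quad_form K z" if "z \<in> carrier_vec n" for z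
    using that D by (simp add: K_def quad_form_uminus_mat)
  have Kpos: "quad_form K z > 0" if z: "z \<in> carrier_vec n" "z \<noteq> 0\<^sub>v n" for z
    using neg[OF z] qN[of "0\<^sub>v p" z] z A B by (simp add: qD)
  then have "pos_def n K" using Ks by (simp add: pos_def_iff_quad_form)
  then obtain Ki where Ki: "pos_def n Ki" "K * Ki = 1\<^sub>m n" by (rule pos_def_mat_inverse)
  have Kic: "Ki \<in> carrier_mat n n" using Ki by (auto simp: pos_def_def sym_mat_def)
  have K0: "quad_form K z \<ge> 0" if "z \<in> carrier_vec n" for z
    using Kpos[OF that] K by (cases "z = 0\<^sub>v n") (auto simp: less_imp_le)
  define X where "X = Ki * transpose_mat B"
  have X: "X \<in> carrier_mat n p" using Kic B by (simp add: X_def)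
  have "K * X = K * Ki * transpose_mat B"
    unfolding X_def using K Kic B by (intro assoc_mult_mat[symmetric, of _ n n _ n _ p]) auto
  then have KX: "K * X = transpose_mat B" using Ki B by simp
  define S where "S = A + transpose_mat X * K * X"
  have XKX: "transpose_mat X * K * X \<in> sym_mat p" by (rule sym_mat_congruence[OF Ks X])
  have Ss: "S \<in> sym_mat p" using As XKX by (auto simp: S_def sym_mat_def transpose_add[of _ p p])
  note Sc = sym_mat_carrier[OF Ss]
  have qS: "quad_form S v = quad_form A v + quad_form K (X *\<^sub>v v)" if v: "v \<in> carrier_vec p" for v
  proof -
    have "S *\<^sub>v v = A *\<^sub>v v + (transpose_mat X * K * X) *\<^sub>v v"
      unfolding S_def using A XKX v by (intro add_mult_distrib_mat_vec[of _ p p]) (auto dest: sym_mat_carrier)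
    then have "quad_form S v = quad_form A v + quad_form (transpose_mat X * K * X) v"
      using A sym_mat_carrier[OF XKX] v X unfolding quad_form_def
      by (simp add: scalar_prod_add_distrib[of _ p])
    then show ?thesis using quad_form_congruence[OF K X v] by simp
  qed
  have complete: "quad_form N (v @\<^sub>v (X *\<^sub>v v + z)) = quad_form S v - quad_form K z"
    if v: "v \<in> carrier_vec p" and z: "z \<in> carrier_vec n" for v z
  proof -
    have Xv: "X *\<^sub>v v \<in> carrier_vec n" using X v by simp
    have KXv: "transpose_mat B *\<^sub>v v = K *\<^sub>v (X *\<^sub>v v)"
      unfolding KX[symmetric] using K X v by (intro assoc_mult_mat_vec[of _ n n _ p]) auto
    have "v \<bullet> (B *\<^sub>v (X *\<^sub>v v + z)) = (K *\<^sub>v (X *\<^sub>v v)) \<bullet> (X *\<^sub>v v + z)"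
      unfolding KXv[symmetric] using B v Xv z by (intro transpose_vec_mult_scalar[symmetric]) auto
    also have "\<dots> = (X *\<^sub>v v + z) \<bullet> (K *\<^sub>v (X *\<^sub>v v))"
      using K Xv z by (intro comm_scalar_prod[of _ n]) auto
    also have "\<dots> = quad_form K (X *\<^sub>v v) + z \<bullet> (K *\<^sub>v (X *\<^sub>v v))"
      unfolding quad_form_def using K Xv z by (intro add_scalar_prod_distrib[of _ n]) auto
    also have "z \<bullet> (K *\<^sub>v (X *\<^sub>v v)) = (X *\<^sub>v v) \<bullet> (K *\<^sub>v z)"
      by (rule sym_mat_bilinear_commute[OF Ks z Xv])
    finally show ?thesis
      using quad_form_add[OF Ks Xv z] Xv z by (simp add: qN[OF v] qD qS[OF v])
  qed
  have split: "X *\<^sub>v v + (z - X *\<^sub>v v) = z" if "v \<in> carrier_vec p" "z \<in> carrier_vec n" for v z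
    using that X by (intro eq_vecI) auto
  have Spsd: "quad_form S v \<ge> 0" if v: "v \<in> carrier_vec p" for v
  proof -
    let ?z = "transpose_mat P0 *\<^sub>v v"
    have z: "?z \<in> carrier_vec n" "?z - X *\<^sub>v v \<in> carrier_vec n" using P0 X v by auto
    show ?thesis
      using complete[OF v z(2)] split[OF v z(1)] P0(2)[OF v] K0[OF z(2)] by simp
  qed
  define z where "z = w - X *\<^sub>v u"
  have z: "z \<in> carrier_vec n" and w_eq: "X *\<^sub>v u + z = w"
    using w X u split[OF u w] by (auto simp: z_def)
  have zK: "quad_form K z \<le> quad_form S u" using complete[OF u z] w_eq uw by simp
  show ?thesis
  proof (cases "quad_form S u = 0")
    case True
    then have "z = 0\<^sub>v n" using zK Kpos[OF z] by force
    then have "X *\<^sub>v u = w" using w_eq X u by simp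
    moreover have "quad_form N (v @\<^sub>v (X *\<^sub>v v)) \<ge> 0" if v: "v \<in> carrier_vec p" for v
      using complete[OF v, of "0\<^sub>v n"] Spsd[OF v] X v K by simp
    ultimately show ?thesis using X by (intro bexI[of _ "transpose_mat X"]) auto
  next
    case False
    then have s: "quad_form S u > 0" using Spsd[OF u] by simp
    let ?s = "quad_form S u"
    define Z where "Z = mat n p (\<lambda>(i, j). z $ i * ((S *\<^sub>v u) $ j / ?s))"
    have Zc: "Z \<in> carrier_mat n p" by (simp add: Z_def)
    have Zv: "Z *\<^sub>v v = ((u \<bullet> (S *\<^sub>v v)) / ?s) \<cdot>\<^sub>v z" if v: "v \<in> carrier_vec p" for v
    proof (rule eq_vecI)
      fix i assume "i < dim_vec (((u \<bullet> (S *\<^sub>v v)) / ?s) \<cdot>\<^sub>v z)"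
      then have i: "i < n" using z by simp
      have "(Z *\<^sub>v v) $ i = (\<Sum>j\<in>{0..<p}. z $ i * ((S *\<^sub>v u) $ j / ?s) * v $ j)"
        using i v by (simp add: Z_def scalar_prod_def)
      also have "\<dots> = (\<Sum>j\<in>{0..<p}. v $ j * (S *\<^sub>v u) $ j) / ?s * z $ i"
        by (simp add: sum_distrib_left sum_distrib_right sum_divide_distrib algebra_simps)
      also have "(\<Sum>j\<in>{0..<p}. v $ j * (S *\<^sub>v u) $ j) = v \<bullet> (S *\<^sub>v u)"
        using Sc by (simp add: scalar_prod_def)
      also have "\<dots> = u \<bullet> (S *\<^sub>v v)" by (rule sym_mat_bilinear_commute[OF Ss v u])
      finally show "(Z *\<^sub>v v) $ i = (((u \<bullet> (S *\<^sub>v v)) / ?s) \<cdot>\<^sub>v z) $ i" using i z by simp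
    qed (use z in \<open>simp add: Z_def\<close>)
    have XZ: "(X + Z) *\<^sub>v v = X *\<^sub>v v + Z *\<^sub>v v" if "v \<in> carrier_vec p" for v
      using X Zc that by (rule add_mult_distrib_mat_vec)
    have "Z *\<^sub>v u = z" using s Zv[OF u] by (simp add: quad_form_def)
    then have "(X + Z) *\<^sub>v u = w" using XZ[OF u] w_eq by simp
    moreover have "quad_form N (v @\<^sub>v ((X + Z) *\<^sub>v v)) \<ge> 0" if v: "v \<in> carrier_vec p" for v
    proof -
      have Zv': "Z *\<^sub>v v \<in> carrier_vec n" using Zc v by simp
      have "quad_form K (Z *\<^sub>v v) = (u \<bullet> (S *\<^sub>v v))\<^sup>2 / ?s\<^sup>2 * quad_form K z"
        unfolding Zv[OF v] using quad_form_smult[OF K z] by (simp add: power_divide)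
      also have "\<dots> \<le> (u \<bullet> (S *\<^sub>v v))\<^sup>2 / ?s\<^sup>2 * ?s" using zK by (intro mult_left_mono) auto
      also have "\<dots> = (u \<bullet> (S *\<^sub>v v))\<^sup>2 / ?s" using s by (simp add: power2_eq_square)
      also have "\<dots> \<le> quad_form S v"
        using semidefinite_Cauchy_Schwarz[OF Ss Spsd u v s] s by (simp add: divide_le_eq mult.commute)
      finally show ?thesis unfolding XZ[OF v] complete[OF v Zv'] by simp
    qed
    ultimately show ?thesis using X Zc by (intro bexI[of _ "transpose_mat (X + Z)"]) auto
  qed
qed

section \<open>Compatible systems\<close>

text \<open>A full-rank choice of \<open>n\<close> columns forms a nonsingular square matrix, whose transpose already
  maps no nonzero vector to zero.\<close>

lemma full_row_rank_transpose_injective: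
  fixes A :: "real mat"
  assumes A: "A \<in> carrier_mat n nc" and rank: "vec_space.rank n A = n"
    and w: "w \<in> carrier_vec n" and Aw: "transpose_mat A *\<^sub>v w = 0\<^sub>v nc"
  shows "w = 0\<^sub>v n"
proof -
  interpret vec_space "TYPE(real)" n .
  obtain S where max: "maximal S (\<lambda>T. T \<subseteq> set (cols A) \<and> lin_indpt T)"
  proof -
    have "lin_indpt {}" by (metis lin_dep_def empty_iff empty_subsetI subset_empty)
    then show ?thesis
      using maximal_exists_superset[of "set (cols A)" "\<lambda>T. T \<subseteq> set (cols A) \<and> lin_indpt T" "{}"] that
      by auto
  qed
  then have S: "S \<subseteq> set (cols A)" "lin_indpt S" by (auto simp: maximal_def)
  have "card S = n" using rank_card_indpt[OF A max] rank by simp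
  moreover have "finite S" using S(1) by (rule finite_subset) simp
  then obtain xs where "set xs = S" "distinct xs" using finite_distinct_list by blast
  ultimately have xs: "set xs = S" "distinct xs" "length xs = n"
    using distinct_card[of xs] by auto
  define M where "M = mat_of_cols n xs"
  have M: "M \<in> carrier_mat n n" using xs by (auto simp: M_def)
  have "set xs \<subseteq> carrier_vec n" 
    using S(1) cols_dim[of A] carrier_matD(1)[OF A] xs(1) by simp
  then have cols: "cols M = xs" unfolding M_def by (rule cols_mat_of_cols)
  have "rank M = n" using lin_indpt_full_rank[OF M] S xs cols by simp
  then have "det (transpose_mat M) \<noteq> 0" using det_rank_iff[OF M] det_transpose[OF M] by simp
  moreover have "transpose_mat M *\<^sub>v w = 0\<^sub>v n"
  proof (rule eq_vecI)
    fix i assume "i < dim_vec (0\<^sub>v n :: real vec)"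
    then have i: "i < n" by simp
    have "xs ! i \<in> set (cols A)" using S xs i by auto
    then obtain j where j: "j < nc" "xs ! i = col A j"
      using A by (auto simp: cols_def)
    have "col A j \<bullet> w = (transpose_mat A *\<^sub>v w) $ j" using A j by simp
    then have "col A j \<bullet> w = 0" using Aw j by simp
    moreover have "col M i = xs ! i" using cols i M by (metis carrier_matD(2) cols_nth)
    ultimately show "(transpose_mat M *\<^sub>v w) $ i = 0\<^sub>v n $ i" using i M j by simp
  qed (use M in simp)
  ultimately show ?thesis
    using det_0_iff_vec_prod_zero_field[of "transpose_mat M" n] M w by auto
qed

lemma H1_carrier: "H1 p L T y \<in> carrier_mat (p * L) (T - L + 1)"
  and H2_carrier: "H2 p L T y \<in> carrier_mat p (T - L + 1)"
  by (simp_all add: H1_def H2_def)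

lemma data_block_carrier: "data_block p L T y \<in> carrier_mat (p + p * L) (p + (T - L + 1))"
  unfolding data_block_def by (rule four_block_carrier_mat[OF one_carrier_mat H1_carrier])

lemma N_mat_sym:
  assumes "Pm \<in> sym_mat (p + (T - L + 1))"
  shows "N_mat p L T Pm y \<in> sym_mat (p + p * L)"
  using sym_mat_congruence[OF assms, of "transpose_mat (data_block p L T y)"] data_block_carrier
  by (simp add: N_mat_def)

text \<open>On vectors \<open>(0, w)\<close> the data enter through \<open>H\<^sub>1(y)\<close> alone; with full row rank this makes the
  lower right block \<open>H\<^sub>1 \<Pi>\<^sub>2\<^sub>2 H\<^sub>1\<^sup>T\<close> of \<open>N\<close> negative definite.\<close>

lemma quad_form_N_mat_lower:
  assumes Pm: "Pm \<in> sym_mat (p + (T - L + 1))"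
    and blocks: "Pm = four_block_mat Pm11 Pm12 Pm21 Pm22" "Pm11 \<in> carrier_mat p p"
      "Pm12 \<in> carrier_mat p (T - L + 1)" "Pm21 \<in> carrier_mat (T - L + 1) p"
      "Pm22 \<in> carrier_mat (T - L + 1) (T - L + 1)"
    and w: "w \<in> carrier_vec (p * L)"
  shows "quad_form (N_mat p L T Pm y) (0\<^sub>v p @\<^sub>v w) =
    quad_form Pm22 (transpose_mat (H1 p L T y) *\<^sub>v w)"
proof -
  let ?D = "data_block p L T y" and ?v = "transpose_mat (H1 p L T y) *\<^sub>v w"
  note H1 = H1_carrier[of p L T y] and H2 = H2_carrier[of p L T y]
  have v: "?v \<in> carrier_vec (T - L + 1)" using H1 w by simp
  have "transpose_mat ?D = four_block_mat (1\<^sub>m p) (0\<^sub>m p (p * L))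
      (transpose_mat (H2 p L T y)) (transpose_mat (H1 p L T y))"
    unfolding data_block_def
    by (subst transpose_four_block_mat[OF one_carrier_mat H2 zero_carrier_mat H1]) simp
  then have "transpose_mat ?D *\<^sub>v (0\<^sub>v p @\<^sub>v w) = 0\<^sub>v p @\<^sub>v ?v"
    using H1 H2 w v by (simp add: four_block_mat_mult_vec[of _ p p _ "p * L" _ "T - L + 1"])
  moreover have "quad_form (N_mat p L T Pm y) (0\<^sub>v p @\<^sub>v w) =
      quad_form Pm (transpose_mat ?D *\<^sub>v (0\<^sub>v p @\<^sub>v w))"
    using quad_form_congruence[OF sym_mat_carrier[OF Pm], of "transpose_mat ?D" "p + p * L"]
      data_block_carrier[of p L T y] w by (simp add: N_mat_def)
  moreover have "quad_form Pm (0\<^sub>v p @\<^sub>v ?v) = quad_form Pm22 ?v"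
    unfolding blocks(1) using blocks(2-) v
    by (simp add: quad_form_four_block[of _ p _ "T - L + 1"])
  ultimately show ?thesis by simp
qed

lemma quad_form_graph:
  assumes N: "N \<in> carrier_mat (p + n) (p + n)" and P: "P \<in> carrier_mat p n" and u: "u \<in> carrier_vec p"
  shows "quad_form (transpose_mat (1\<^sub>m p @\<^sub>r transpose_mat P) * N * (1\<^sub>m p @\<^sub>r transpose_mat P)) u =
    quad_form N (u @\<^sub>v (transpose_mat P *\<^sub>v u))"
proof -
  have "1\<^sub>m p @\<^sub>r transpose_mat P \<in> carrier_mat (p + n) p" using P by auto
  moreover have "(1\<^sub>m p @\<^sub>r transpose_mat P) *\<^sub>v u = u @\<^sub>v (transpose_mat P *\<^sub>v u)"
    using mat_mult_append[of "1\<^sub>m p" p p "transpose_mat P" n u] P u by simp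
  ultimately show ?thesis using quad_form_congruence[OF N _ u] by simp
qed

lemma compatible_iff_quad_form:
  assumes Pm: "Pm \<in> sym_mat (p + (T - L + 1))"
  shows "compatible p L T Pm y P \<longleftrightarrow> P \<in> carrier_mat p (p * L) \<and>
    (\<forall>u \<in> carrier_vec p. quad_form (N_mat p L T Pm y) (u @\<^sub>v (transpose_mat P *\<^sub>v u)) \<ge> 0)"
proof (cases "P \<in> carrier_mat p (p * L)")
  case P: True
  note N = N_mat_sym[OF Pm, of y]
  have "transpose_mat (1\<^sub>m p @\<^sub>r transpose_mat P) * N_mat p L T Pm y * (1\<^sub>m p @\<^sub>r transpose_mat P) \<in> sym_mat p"
    using P by (intro sym_mat_congruence[OF N]) auto
  then show ?thesis
    using P quad_form_graph[OF sym_mat_carrier[OF N] P]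
    by (simp add: compatible_def pos_semidef_iff_quad_form)
qed (simp add: compatible_def)

section \<open>The companion matrix\<close>

text \<open>The empty lower block row makes this literally the upper left block of \<open>E_mat\<close>.\<close>

definition neg_last_block :: "nat \<Rightarrow> nat \<Rightarrow> real mat" where
  "neg_last_block p L =
     four_block_mat (0\<^sub>m p (p * (L - 1))) (- 1\<^sub>m p) (0\<^sub>m 0 (p * (L - 1))) (0\<^sub>m 0 p)"

text \<open>The matrix with the rows of \<open>J\<close> above those of \<open>- P\<close>. The transpose of \<open>[0 -I]\<close> puts a negated
  copy of \<open>P\<close> into the rows where \<open>J0\<close> vanishes, and in this form the transpose of the companion matrix
  is expressed by the same two matrices that enter the linear matrix inequality.\<close>

definition companion :: "nat \<Rightarrow> nat \<Rightarrow> real mat \<Rightarrow> real mat" where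
  "companion p L P = J0 p L + transpose_mat (neg_last_block p L) * P"

lemma order_dim: "L \<ge> 1 \<Longrightarrow> p * L = p + p * (L - 1)" for p L :: nat
  by (cases L) auto

lemma neg_last_block_carrier: "L \<ge> 1 \<Longrightarrow> neg_last_block p L \<in> carrier_mat p (p * L)"
  by (auto simp: neg_last_block_def order_dim)

lemma J0_carrier: "L \<ge> 1 \<Longrightarrow> J0 p L \<in> carrier_mat (p * L) (p * L)"
  by (auto simp: J0_def order_dim)

lemma companion_carrier:
  "L \<ge> 1 \<Longrightarrow> P \<in> carrier_mat p (p * L) \<Longrightarrow> companion p L P \<in> carrier_mat (p * L) (p * L)"
  using J0_carrier[of L p] neg_last_block_carrier[of L p] by (simp add: companion_def)

lemma transpose_companion_mult_vec:
  assumes L: "L \<ge> 1" and P: "P \<in> carrier_mat p (p * L)" and x: "x \<in> carrier_vec (p * L)"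
  shows "transpose_mat (companion p L P) *\<^sub>v x =
    transpose_mat (J0 p L) *\<^sub>v x + transpose_mat P *\<^sub>v (neg_last_block p L *\<^sub>v x)"
proof -
  let ?G = "neg_last_block p L"
  note J = J0_carrier[OF L, of p] and G = neg_last_block_carrier[OF L, of p]
  have "transpose_mat (companion p L P) = transpose_mat (J0 p L) + transpose_mat (transpose_mat ?G * P)"
    unfolding companion_def using J G P by (intro transpose_add[of _ "p * L" "p * L"]) auto
  also have "transpose_mat (transpose_mat ?G * P) = transpose_mat P * ?G"
    using G P by (simp add: transpose_mult[of _ "p * L" p _ "p * L"])
  finally show ?thesis using J G P x
    by (simp add: add_mult_distrib_mat_vec[of _ "p * L" "p * L"])
qed

lemma companion_mult_vec:
  assumes L: "L \<ge> 1" and P: "P \<in> carrier_mat p (p * L)"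
    and x1: "x1 \<in> carrier_vec p" and x2: "x2 \<in> carrier_vec (p * (L - 1))"
  shows "companion p L P *\<^sub>v (x1 @\<^sub>v x2) = x2 @\<^sub>v - (P *\<^sub>v (x1 @\<^sub>v x2))"
proof -
  let ?G = "neg_last_block p L" and ?m = "p * (L - 1)" and ?x = "x1 @\<^sub>v x2"
  note J = J0_carrier[OF L, of p] and G = neg_last_block_carrier[OF L, of p]
  have x: "?x \<in> carrier_vec (p * L)" using x1 x2 order_dim[OF L] by (metis append_carrier_vec)
  have Jx: "J0 p L *\<^sub>v ?x = x2 @\<^sub>v 0\<^sub>v p"
    unfolding J0_def using x1 x2 by (simp add: four_block_mat_mult_vec[of _ ?m p _ ?m _ p])
  have Gu: "transpose_mat ?G *\<^sub>v u = 0\<^sub>v ?m @\<^sub>v - u" if u: "u \<in> carrier_vec p" for u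
  proof -
    have Gt: "transpose_mat ?G = four_block_mat (0\<^sub>m ?m p) (0\<^sub>m ?m 0) (- 1\<^sub>m p) (0\<^sub>m p 0)"
      unfolding neg_last_block_def
      by (subst transpose_four_block_mat[of _ p ?m _ p _ 0]) (auto simp: transpose_uminus)
    have "u = u @\<^sub>v 0\<^sub>v 0" using u by (intro eq_vecI) auto
    then have "transpose_mat ?G *\<^sub>v u = transpose_mat ?G *\<^sub>v (u @\<^sub>v 0\<^sub>v 0)" by simp
    also have "\<dots> = 0\<^sub>v ?m @\<^sub>v - u"
      unfolding Gt using u
      by (subst four_block_mat_mult_vec[of _ ?m p _ 0 _ p]) auto
    finally show ?thesis .
  qed
  have Px: "P *\<^sub>v ?x \<in> carrier_vec p" using P x by simp
  have "companion p L P *\<^sub>v ?x = J0 p L *\<^sub>v ?x + (transpose_mat ?G * P) *\<^sub>v ?x"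
    unfolding companion_def using J G P x by (intro add_mult_distrib_mat_vec[of _ "p * L" "p * L"]) auto
  also have "(transpose_mat ?G * P) *\<^sub>v ?x = 0\<^sub>v ?m @\<^sub>v - (P *\<^sub>v ?x)"
    using G P x Gu[OF Px] by simp
  also have "J0 p L *\<^sub>v ?x + \<dots> = x2 @\<^sub>v - (P *\<^sub>v ?x)"
    unfolding Jx using x2 Px by (subst append_vec_add[of _ ?m _ _ p]) auto
  finally show ?thesis .
qed

lemma stacked_Suc:
  assumes p: "p \<ge> 1" and L: "L \<ge> 1" and P: "P \<in> carrier_mat p (p * L)" and y: "y \<in> behavior p L P"
  shows "stacked p L y (Suc t) = companion p L P *\<^sub>v stacked p L y t"
proof -
  let ?m = "p * (L - 1)"
  let ?x2 = "vec ?m (\<lambda>k. y (Suc t + k div p) $ (k mod p))"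
  have yc: "\<And>t. y t \<in> carrier_vec p" and shift: "shift_op p L P y t = 0\<^sub>v p"
    using y by (auto simp: behavior_def)
  have now: "stacked p L y t = y t @\<^sub>v ?x2"
  proof (rule eq_vecI)
    fix i assume "i < dim_vec (y t @\<^sub>v ?x2)"
    then have i: "i < p + ?m" using yc[of t] by simp
    show "stacked p L y t $ i = (y t @\<^sub>v ?x2) $ i"
    proof (cases "i < p")
      case True
      then show ?thesis using i yc[of t] order_dim[OF L, of p] by (simp add: stacked_def)
    next
      case False
      then have "i div p = Suc ((i - p) div p)" "i mod p = (i - p) mod p"
        using p by (simp_all add: le_div_geq le_mod_geq)
      then show ?thesis using False i yc[of t] order_dim[OF L, of p] by (simp add: stacked_def)
    qed
  qed (use yc[of t] order_dim[OF L, of p] in \<open>simp add: stacked_def\<close>)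
  have st: "stacked p L y t \<in> carrier_vec (p * L)" by (simp add: stacked_def)
  have last: "y (t + L) = - (P *\<^sub>v stacked p L y t)"
  proof (rule eq_vecI)
    fix r assume "r < dim_vec (- (P *\<^sub>v stacked p L y t))"
    then have r: "r < p" using P by simp
    have "shift_op p L P y t $ r = y (t + L) $ r + row P r \<bullet> stacked p L y t"
      using p r yc by (intro shift_op_eq[OF P, of "t + L"]) auto
    then show "y (t + L) $ r = (- (P *\<^sub>v stacked p L y t)) $ r"
      using shift r P by simp
  qed (use yc[of "t + L"] P in simp)
  have "stacked p L y (Suc t) = ?x2 @\<^sub>v y (t + L)"
  proof (rule eq_vecI)
    fix i assume "i < dim_vec (?x2 @\<^sub>v y (t + L))"
    then have i: "i < ?m + p" using yc[of "t + L"] by simp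
    show "stacked p L y (Suc t) $ i = (?x2 @\<^sub>v y (t + L)) $ i"
    proof (cases "i < ?m")
      case True
      then show ?thesis using i yc[of "t + L"] order_dim[OF L, of p] by (simp add: stacked_def)
    next
      case False
      define j where "j = i - ?m"
      have j: "i = j + p * (L - 1)" "j < p" using False i by (auto simp: j_def)
      have "i div p = L - 1" "i mod p = j" unfolding j(1) using j(2) by simp_all
      then show ?thesis
        using False i L yc[of "t + L"] order_dim[OF L, of p] by (simp add: stacked_def j_def)
    qed
  qed (use yc[of "t + L"] order_dim[OF L, of p] in \<open>simp add: stacked_def\<close>)
  also have "\<dots> = companion p L P *\<^sub>v stacked p L y t"
    using companion_mult_vec[OF L P yc[of t], of ?x2] by (simp add: last now)
  finally show ?thesis .
qed

text \<open>The rate of the form at \<open>t\<close> is the difference of the two sides of the contraction inequality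
  at the stacked vector at \<open>t\<close>. It vanishes only if that vector does, and its first \<open>p\<close> coordinates
  are those of \<open>y t\<close>.\<close>

lemma contraction_imp_qdf_lyapunov:
  assumes p: "p \<ge> 1" and L: "L \<ge> 1" and P: "P \<in> carrier_mat p (p * L)"
    and \<Psi>: "pos_def (p * L) \<Psi>"
    and contr: "\<And>x. x \<in> carrier_vec (p * L) \<Longrightarrow> x \<noteq> 0\<^sub>v (p * L) \<Longrightarrow>
      quad_form \<Psi> (companion p L P *\<^sub>v x) < quad_form \<Psi> x"
  shows "qdf_lyapunov p L P \<Psi>"
  unfolding qdf_lyapunov_def
proof (intro conjI ballI allI impI)
  show "\<Psi> \<in> sym_mat (p * L)" using \<Psi> by (simp add: pos_def_def)
  then have \<Psi>c: "\<Psi> \<in> carrier_mat (p * L) (p * L)" by (rule sym_mat_carrier)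
  fix y assume y: "y \<in> behavior p L P"
  have st: "stacked p L y t \<in> carrier_vec (p * L)" for t by (simp add: stacked_def)
  have qdf: "qdf p L \<Psi> y t = quad_form \<Psi> (stacked p L y t)" for t
    by (simp add: qdf_def quad_form_def)
  have rate: "qdf_rate p L \<Psi> y t =
      quad_form \<Psi> (companion p L P *\<^sub>v stacked p L y t) - quad_form \<Psi> (stacked p L y t)" for t
    using stacked_Suc[OF p L P y, of t] by (simp add: qdf_rate_def qdf)
  have C0: "companion p L P *\<^sub>v 0\<^sub>v (p * L) = 0\<^sub>v (p * L)"
    using companion_carrier[OF L P] by simp
  show "qdf p L \<Psi> y t \<ge> 0" for t
    using \<Psi> \<Psi>c st[of t] unfolding qdf
    by (cases "stacked p L y t = 0\<^sub>v (p * L)") (auto simp: pos_def_iff_quad_form less_imp_le)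
  show "qdf_rate p L \<Psi> y t \<le> 0" for t
    using contr[OF st[of t]] unfolding rate
    by (cases "stacked p L y t = 0\<^sub>v (p * L)") (auto simp: C0 less_imp_le)
  show "y t = 0\<^sub>v p" if "\<forall>t. qdf_rate p L \<Psi> y t = 0" for t
  proof -
    have "qdf_rate p L \<Psi> y t = 0" using that by simp
    then have "stacked p L y t = 0\<^sub>v (p * L)"
      using contr[OF st[of t]] unfolding rate by force
    then have zero: "stacked p L y t $ i = 0" if "i < p * L" for i using that by simp
    have yc: "y t \<in> carrier_vec p" using y by (simp add: behavior_def)
    show ?thesis
    proof (rule eq_vecI)
      fix i assume "i < dim_vec (0\<^sub>v p :: real vec)"
      then have i: "i < p" by simp
      then have "i < p * L" using order_dim[OF L, of p] by simp
      then show "y t $ i = 0\<^sub>v p $ i" using zero[of i] i by (simp add: stacked_def)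
    qed (use yc in simp)
  qed
qed

section \<open>Quadratic stability and the linear matrix inequality as contraction conditions\<close>

text \<open>Split \<open>x\<close> into its first \<open>p\<close> coordinates \<open>x1\<close> and the rest \<open>x2\<close>. The vector \<open>[I; -P] x\<close> is
  \<open>(x, - P x)\<close> and also \<open>(x1, (x2, - P x))\<close>, whose second component is the companion matrix applied
  to \<open>x\<close>. One block matrix picks \<open>x\<close>, the other this component.\<close>

lemma quadratic_stability_iff_contraction:
  assumes L: "L \<ge> 1" and P: "P \<in> carrier_mat p (p * L)" and \<Psi>: "\<Psi> \<in> sym_mat (p * L)"
  shows "neg_def (p * L)
      (transpose_mat (1\<^sub>m (p * L) @\<^sub>r (- P)) *
       (four_block_mat (0\<^sub>m p p) (0\<^sub>m p (p * L)) (0\<^sub>m (p * L) p) \<Psi> -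
        four_block_mat \<Psi> (0\<^sub>m (p * L) p) (0\<^sub>m p (p * L)) (0\<^sub>m p p)) *
       (1\<^sub>m (p * L) @\<^sub>r (- P))) \<longleftrightarrow>
    (\<forall>x \<in> carrier_vec (p * L). x \<noteq> 0\<^sub>v (p * L) \<longrightarrow>
       quad_form \<Psi> (companion p L P *\<^sub>v x) < quad_form \<Psi> x)"
proof -
  let ?n = "p * L" and ?m = "p * (L - 1)"
  let ?S = "1\<^sub>m ?n @\<^sub>r (- P)"
  let ?D1 = "four_block_mat (0\<^sub>m p p) (0\<^sub>m p ?n) (0\<^sub>m ?n p) \<Psi>"
  let ?D2 = "four_block_mat \<Psi> (0\<^sub>m ?n p) (0\<^sub>m p ?n) (0\<^sub>m p p)"
  note \<Psi>c = sym_mat_carrier[OF \<Psi>]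
  have z: "0\<^sub>m p p \<in> sym_mat p" by (simp add: sym_mat_def)
  have D1: "?D1 \<in> sym_mat (?n + p)"
    using sym_four_blockI[OF z _ \<Psi>, of "0\<^sub>m p ?n"] by (simp add: add.commute)
  have D2: "?D2 \<in> sym_mat (?n + p)"
    using sym_four_blockI[OF \<Psi> _ z, of "0\<^sub>m ?n p"] by simp
  note D = sym_mat_minus[OF D1 D2]
  have S: "?S \<in> carrier_mat (?n + p) ?n" using P by auto
  have "quad_form (transpose_mat ?S * (?D1 - ?D2) * ?S) x =
      quad_form \<Psi> (companion p L P *\<^sub>v x) - quad_form \<Psi> x" if x: "x \<in> carrier_vec ?n" for x
  proof -
    define x1 x2 where "x1 = vec_first x p" and "x2 = vec_last x ?m"
    have x1: "x1 \<in> carrier_vec p" and x2: "x2 \<in> carrier_vec ?m" and x_eq: "x1 @\<^sub>v x2 = x"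
      using x order_dim[OF L, of p] by (auto simp: x1_def x2_def)
    have Px: "- (P *\<^sub>v x) \<in> carrier_vec p" using P x by simp
    have Cx: "companion p L P *\<^sub>v x \<in> carrier_vec ?n" using companion_carrier[OF L P] x by simp
    have Sx: "?S *\<^sub>v x = x @\<^sub>v - (P *\<^sub>v x)"
      using mat_mult_append[of "1\<^sub>m ?n" ?n ?n "- P" p x] P x by simp
    have "x @\<^sub>v - (P *\<^sub>v x) = x1 @\<^sub>v (x2 @\<^sub>v - (P *\<^sub>v x))"
      unfolding x_eq[symmetric] using x1 x2 P by (intro eq_vecI) auto
    also have "x2 @\<^sub>v - (P *\<^sub>v x) = companion p L P *\<^sub>v x"
      using companion_mult_vec[OF L P x1 x2] by (simp add: x_eq)
    finally have shift: "x @\<^sub>v - (P *\<^sub>v x) = x1 @\<^sub>v (companion p L P *\<^sub>v x)" .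
    have "quad_form (transpose_mat ?S * (?D1 - ?D2) * ?S) x = quad_form (?D1 - ?D2) (?S *\<^sub>v x)"
      by (rule quad_form_congruence[OF sym_mat_carrier[OF D] S x])
    also have "\<dots> = quad_form ?D1 (?S *\<^sub>v x) - quad_form ?D2 (?S *\<^sub>v x)"
      using D1 D2 S x by (intro quad_form_minus_mat[of _ "?n + p"] sym_mat_carrier) auto
    also have "quad_form ?D1 (?S *\<^sub>v x) = quad_form \<Psi> (companion p L P *\<^sub>v x)"
      unfolding Sx shift
      by (subst quad_form_four_block[of _ p _ ?n]) (use x1 Cx \<Psi>c in auto)
    also have "quad_form ?D2 (?S *\<^sub>v x) = quad_form \<Psi> x"
      unfolding Sx by (subst quad_form_four_block[of _ ?n _ p]) (use x Px \<Psi>c in auto)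
    finally show ?thesis .
  qed
  then show ?thesis using sym_mat_congruence[OF D S] by (simp add: neg_def_iff_quad_form)
qed

text \<open>The part of the linear matrix inequality that depends on \<open>\<Phi>\<close>; it is linear in \<open>\<Phi>\<close>.\<close>

definition lmi_block :: "nat \<Rightarrow> nat \<Rightarrow> real mat \<Rightarrow> real mat" where
  "lmi_block p L \<Phi> = four_block_mat
     (\<Phi> - J0 p L * \<Phi> * transpose_mat (J0 p L)) (- (J0 p L * \<Phi>))
     (- (\<Phi> * transpose_mat (J0 p L))) (- \<Phi>)"

lemma lmi_block_sym:
  assumes L: "L \<ge> 1" and \<Phi>: "\<Phi> \<in> sym_mat (p * L)"
  shows "lmi_block p L \<Phi> \<in> sym_mat (p * L + p * L)"
proof -
  let ?J = "J0 p L"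
  note J = J0_carrier[OF L, of p] and \<Phi>c = sym_mat_carrier[OF \<Phi>]
  have t: "transpose_mat (- (?J * \<Phi>)) = - (\<Phi> * transpose_mat ?J)"
    using transpose_mult[OF J \<Phi>c] \<Phi> by (simp add: transpose_uminus sym_mat_def)
  have "\<Phi> - ?J * \<Phi> * transpose_mat ?J \<in> sym_mat (p * L)"
    using sym_mat_minus[OF \<Phi> sym_mat_congruence[OF \<Phi>, of "transpose_mat ?J" "p * L"]] J by simp
  moreover have "- \<Phi> \<in> sym_mat (p * L)" using \<Phi> by (simp add: sym_mat_def transpose_uminus)
  ultimately show ?thesis
    unfolding lmi_block_def t[symmetric] using J \<Phi>c by (intro sym_four_blockI) auto
qed

lemma quad_form_lmi_block:
  assumes L: "L \<ge> 1" and \<Phi>: "\<Phi> \<in> sym_mat (p * L)"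
    and x: "x \<in> carrier_vec (p * L)" and w: "w \<in> carrier_vec (p * L)"
  shows "quad_form (lmi_block p L \<Phi>) (x @\<^sub>v w) =
    quad_form \<Phi> x - quad_form \<Phi> (transpose_mat (J0 p L) *\<^sub>v x + w)"
proof -
  let ?J = "J0 p L" and ?n = "p * L"
  let ?v = "transpose_mat ?J *\<^sub>v x"
  note J = J0_carrier[OF L, of p] and \<Phi>c = sym_mat_carrier[OF \<Phi>]
  have v: "?v \<in> carrier_vec ?n" using J x by simp
  have Jw: "(?J * \<Phi>) *\<^sub>v w = ?J *\<^sub>v (\<Phi> *\<^sub>v w)" using J \<Phi>c w by simp
  have 1: "x \<bullet> (- (?J * \<Phi>) *\<^sub>v w) = - (?v \<bullet> (\<Phi> *\<^sub>v w))"
    using J \<Phi>c x w Jw transpose_vec_mult_scalar[OF J _ x, of "\<Phi> *\<^sub>v w"] by simp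
  have 2: "w \<bullet> (- (\<Phi> * transpose_mat ?J) *\<^sub>v x) = - (?v \<bullet> (\<Phi> *\<^sub>v w))"
    using J \<Phi>c x w sym_mat_bilinear_commute[OF \<Phi> w v] by simp
  have W: "?J * \<Phi> * transpose_mat ?J \<in> carrier_mat ?n ?n" using J \<Phi>c by simp
  have qW: "quad_form (?J * \<Phi> * transpose_mat ?J) x = quad_form \<Phi> ?v"
    using quad_form_congruence[OF \<Phi>c, of "transpose_mat ?J" ?n x] J x by simp
  have "quad_form (lmi_block p L \<Phi>) (x @\<^sub>v w) =
      quad_form (\<Phi> - ?J * \<Phi> * transpose_mat ?J) x + x \<bullet> (- (?J * \<Phi>) *\<^sub>v w) +
      w \<bullet> (- (\<Phi> * transpose_mat ?J) *\<^sub>v x) + quad_form (- \<Phi>) w"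
    unfolding lmi_block_def using J \<Phi>c W x w by (intro quad_form_four_block[of _ ?n _ ?n] minus_carrier_mat) auto
  also have "\<dots> = quad_form \<Phi> x - quad_form \<Phi> ?v - 2 * (?v \<bullet> (\<Phi> *\<^sub>v w)) - quad_form \<Phi> w"
    unfolding 1 2 quad_form_minus_mat[OF \<Phi>c W x] qW quad_form_uminus_mat[OF \<Phi>c w] by simp
  finally have "quad_form (lmi_block p L \<Phi>) (x @\<^sub>v w) =
      quad_form \<Phi> x - quad_form \<Phi> ?v - 2 * (?v \<bullet> (\<Phi> *\<^sub>v w)) - quad_form \<Phi> w" .
  then show ?thesis using quad_form_add[OF \<Phi> v w] by simp
qed

lemma E_mat_carrier: "L \<ge> 1 \<Longrightarrow> E_mat p L \<in> carrier_mat (p + p * L) (p * L + p * L)"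
  using neg_last_block_carrier[of L p] by (auto simp: E_mat_def neg_last_block_def)

lemma N_bar_sym:
  assumes L: "L \<ge> 1" and Pm: "Pm \<in> sym_mat (p + (T - L + 1))"
  shows "N_bar p L T Pm y \<in> sym_mat (p * L + p * L)"
  unfolding N_bar_def by (rule sym_mat_congruence[OF N_mat_sym[OF Pm] E_mat_carrier[OF L]])

lemma quad_form_N_bar:
  assumes L: "L \<ge> 1" and Pm: "Pm \<in> sym_mat (p + (T - L + 1))"
    and x: "x \<in> carrier_vec (p * L)" and w: "w \<in> carrier_vec (p * L)"
  shows "quad_form (N_bar p L T Pm y) (x @\<^sub>v w) =
    quad_form (N_mat p L T Pm y) ((neg_last_block p L *\<^sub>v x) @\<^sub>v w)"
proof -
  let ?G = "neg_last_block p L"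
  note G = neg_last_block_carrier[OF L, of p]
  have Gx: "?G *\<^sub>v x \<in> carrier_vec p" using G x by simp
  have "E_mat p L *\<^sub>v (x @\<^sub>v w) = (?G *\<^sub>v x) @\<^sub>v w"
    unfolding E_mat_def neg_last_block_def[symmetric] using G x w Gx
    by (simp add: four_block_mat_mult_vec[of _ p "p * L" _ "p * L" _ "p * L"])
  moreover have "x @\<^sub>v w \<in> carrier_vec (p * L + p * L)" using x w by simp
  ultimately show ?thesis
    unfolding N_bar_def
    by (simp add: quad_form_congruence[OF sym_mat_carrier[OF N_mat_sym[OF Pm]] E_mat_carrier[OF L]])
qed

lemma append_vec_eq_zero_iff:
  assumes "x \<in> carrier_vec a" "w \<in> carrier_vec b"
  shows "x @\<^sub>v w = 0\<^sub>v (a + b) \<longleftrightarrow> x = 0\<^sub>v a \<and> w = 0\<^sub>v b"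
proof -
  have "0\<^sub>v (a + b) = 0\<^sub>v a @\<^sub>v (0\<^sub>v b :: 'a vec)" by (intro eq_vecI) auto
  then show ?thesis using append_vec_eq[OF assms(1), of "0\<^sub>v a"] by simp
qed

lemma stability_lmi_iff_quad_form:
  assumes L: "L \<ge> 1" and Pm: "Pm \<in> sym_mat (p + (T - L + 1))" and \<Phi>: "\<Phi> \<in> sym_mat (p * L)"
  shows "stability_lmi p L T Pm y \<Phi> \<longleftrightarrow>
    (\<forall>z \<in> carrier_vec (p * L + p * L). z \<noteq> 0\<^sub>v (p * L + p * L) \<longrightarrow>
       quad_form (lmi_block p L \<Phi>) z > quad_form (N_bar p L T Pm y) z)"
proof -
  note M = lmi_block_sym[OF L \<Phi>] and N = N_bar_sym[OF L Pm, of y]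
  have "2 * (p * L) = p * L + p * L" by simp
  then have "stability_lmi p L T Pm y \<Phi> \<longleftrightarrow>
      pos_def (p * L + p * L) (lmi_block p L \<Phi> - N_bar p L T Pm y)"
    by (simp only: stability_lmi_def lmi_block_def)
  then show ?thesis
    using sym_mat_minus[OF M N] sym_mat_carrier[OF M] sym_mat_carrier[OF N]
    by (simp add: pos_def_iff_quad_form quad_form_minus_mat)
qed

text \<open>Evaluate the linear matrix inequality at \<open>(x, P\<^sup>T u)\<close> with \<open>u = [0 -I] x\<close>: the data term is
  nonnegative by compatibility of \<open>P\<close>.\<close>

lemma stability_lmi_imp_dual_contraction:
  assumes L: "L \<ge> 1" and Pm: "Pm \<in> sym_mat (p + (T - L + 1))" and \<Phi>: "\<Phi> \<in> sym_mat (p * L)"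
    and lmi: "stability_lmi p L T Pm y \<Phi>" and P: "compatible p L T Pm y P"
    and x: "x \<in> carrier_vec (p * L)" "x \<noteq> 0\<^sub>v (p * L)"
  shows "quad_form \<Phi> (transpose_mat (companion p L P) *\<^sub>v x) < quad_form \<Phi> x"
proof -
  let ?u = "neg_last_block p L *\<^sub>v x"
  let ?w = "transpose_mat P *\<^sub>v ?u"
  have Pc: "P \<in> carrier_mat p (p * L)"
    and Pq: "\<And>u. u \<in> carrier_vec p \<Longrightarrow> quad_form (N_mat p L T Pm y) (u @\<^sub>v (transpose_mat P *\<^sub>v u)) \<ge> 0"
    using P by (auto simp: compatible_iff_quad_form[OF Pm])
  have u: "?u \<in> carrier_vec p" using neg_last_block_carrier[OF L, of p] x by simp
  have w: "?w \<in> carrier_vec (p * L)" using mult_mat_vec_carrier[OF _ u, of "transpose_mat P"] Pc by simp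
  have "x @\<^sub>v ?w \<noteq> 0\<^sub>v (p * L + p * L)" using append_vec_eq_zero_iff[OF x(1) w] x(2) by simp
  moreover have "x @\<^sub>v ?w \<in> carrier_vec (p * L + p * L)" using x w by simp
  ultimately have "quad_form (N_bar p L T Pm y) (x @\<^sub>v ?w) < quad_form (lmi_block p L \<Phi>) (x @\<^sub>v ?w)"
    using lmi by (simp add: stability_lmi_iff_quad_form[OF L Pm \<Phi>])
  moreover have "0 \<le> quad_form (N_bar p L T Pm y) (x @\<^sub>v ?w)"
    using Pq[OF u] by (simp add: quad_form_N_bar[OF L Pm x(1) w])
  ultimately show ?thesis
    using quad_form_lmi_block[OF L \<Phi> x(1) w] transpose_companion_mult_vec[OF L Pc x(1)] by simp
qed

text \<open>Interpolation turns the hypothesis on all compatible systems into the implication between two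
  quadratic forms that the S-lemma needs. The multiplier \<open>\<beta>\<close> is absorbed into \<open>\<Phi>\<close>, as
  \<open>lmi_block\<close> is homogeneous.\<close>

lemma dual_contraction_imp_stability_lmi:
  assumes L: "L \<ge> 1" and Pm: "Pm \<in> sym_mat (p + (T - L + 1))" and \<Phi>: "pos_def (p * L) \<Phi>"
    and neg: "\<And>w. w \<in> carrier_vec (p * L) \<Longrightarrow> w \<noteq> 0\<^sub>v (p * L) \<Longrightarrow>
      quad_form (N_mat p L T Pm y) (0\<^sub>v p @\<^sub>v w) < 0"
    and P0: "compatible p L T Pm y P0"
    and contr: "\<And>P x. compatible p L T Pm y P \<Longrightarrow> x \<in> carrier_vec (p * L) \<Longrightarrow> x \<noteq> 0\<^sub>v (p * L) \<Longrightarrow>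
      quad_form \<Phi> (transpose_mat (companion p L P) *\<^sub>v x) < quad_form \<Phi> x"
  shows "\<exists>\<beta>>0. stability_lmi p L T Pm y (\<beta> \<cdot>\<^sub>m \<Phi>)"
proof -
  let ?n = "p * L"
  have \<Phi>s: "\<Phi> \<in> sym_mat ?n" using \<Phi> by (simp add: pos_def_def)
  note \<Phi>c = sym_mat_carrier[OF \<Phi>s]
  note M = lmi_block_sym[OF L \<Phi>s] and N = N_bar_sym[OF L Pm, of y]
  have "quad_form (lmi_block p L \<Phi>) z > 0"
    if z: "z \<in> carrier_vec (?n + ?n)" "z \<noteq> 0\<^sub>v (?n + ?n)" and nonneg: "quad_form (N_bar p L T Pm y) z \<ge> 0" for z
  proof -
    define x w where "x = vec_first z ?n" and "w = vec_last z ?n"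
    have x: "x \<in> carrier_vec ?n" and w: "w \<in> carrier_vec ?n" and z_eq: "z = x @\<^sub>v w"
      using z by (auto simp: x_def w_def)
    let ?u = "neg_last_block p L *\<^sub>v x"
    have u: "?u \<in> carrier_vec p" using neg_last_block_carrier[OF L, of p] x by simp
    have uw: "quad_form (N_mat p L T Pm y) (?u @\<^sub>v w) \<ge> 0"
      using nonneg by (simp add: z_eq quad_form_N_bar[OF L Pm x w])
    obtain P where P: "P \<in> carrier_mat p ?n" "transpose_mat P *\<^sub>v ?u = w"
      and "\<forall>v \<in> carrier_vec p. quad_form (N_mat p L T Pm y) (v @\<^sub>v (transpose_mat P *\<^sub>v v)) \<ge> 0"
      using quadratic_matrix_inequality_interpolation[OF N_mat_sym[OF Pm] neg _ _ u w uw, of P0]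
        P0 by (auto simp: compatible_iff_quad_form[OF Pm])
    then have comp: "compatible p L T Pm y P" by (simp add: compatible_iff_quad_form[OF Pm])
    \<comment> \<open>If \<open>x\<close> vanished, so would \<open>u\<close> and \<open>w = P\<^sup>T u\<close>.\<close>
    have "x \<noteq> 0\<^sub>v ?n"
    proof
      assume "x = 0\<^sub>v ?n"
      then have "w = 0\<^sub>v ?n" using P neg_last_block_carrier[OF L, of p] by auto
      then show False using z(2) append_vec_eq_zero_iff[OF x w] \<open>x = 0\<^sub>v ?n\<close> by (simp add: z_eq)
    qed
    then show ?thesis
      using contr[OF comp x] transpose_companion_mult_vec[OF L P(1) x]
      by (simp add: z_eq quad_form_lmi_block[OF L \<Phi>s x w] P(2))
  qed
  then obtain \<beta> where \<beta>: "\<beta> > 0" and S: "\<And>z. z \<in> carrier_vec (?n + ?n) \<Longrightarrow> z \<noteq> 0\<^sub>v (?n + ?n) \<Longrightarrow>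
      \<beta> * quad_form (lmi_block p L \<Phi>) z > quad_form (N_bar p L T Pm y) z"
    using strict_S_lemma[OF M N] by blast
  have \<beta>\<Phi>: "\<beta> \<cdot>\<^sub>m \<Phi> \<in> sym_mat ?n" by (rule sym_mat_smult[OF \<Phi>s])
  have "quad_form (lmi_block p L (\<beta> \<cdot>\<^sub>m \<Phi>)) z = \<beta> * quad_form (lmi_block p L \<Phi>) z"
    if z: "z \<in> carrier_vec (?n + ?n)" for z
  proof -
    define x w where "x = vec_first z ?n" and "w = vec_last z ?n"
    have x: "x \<in> carrier_vec ?n" and w: "w \<in> carrier_vec ?n" and z_eq: "z = x @\<^sub>v w"
      using z by (auto simp: x_def w_def)
    have "transpose_mat (J0 p L) *\<^sub>v x + w \<in> carrier_vec ?n" using J0_carrier[OF L, of p] x w by simp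
    then show ?thesis using x
      by (simp add: z_eq quad_form_lmi_block[OF L _ x w] \<Phi>s \<beta>\<Phi> quad_form_smult_mat[OF \<Phi>c] right_diff_distrib)
  qed
  then have "stability_lmi p L T Pm y (\<beta> \<cdot>\<^sub>m \<Phi>)"
    using S by (simp add: stability_lmi_iff_quad_form[OF L Pm \<beta>\<Phi>])
  then show ?thesis using \<beta> by blast
qed

section \<open>Informativity for quadratic stability\<close>

theorem theorem16:
  fixes p L T :: nat
    and Pm Pm11 Pm12 Pm21 Pm22 :: "real mat"
    and y :: "nat \<Rightarrow> real vec"
  assumes "p \<ge> 1" and "L \<ge> 1" and "T \<ge> L"
    and "Pm \<in> sym_mat (p + (T - L + 1))"
    and "Pm = four_block_mat Pm11 Pm12 Pm21 Pm22"
    and "Pm11 \<in> sym_mat p"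
    and "Pm12 \<in> carrier_mat p (T - L + 1)"
    and "Pm21 \<in> carrier_mat (T - L + 1) p"
    and "Pm22 \<in> sym_mat (T - L + 1)"
    and "neg_def (T - L + 1) Pm22"
    and "pos_semidef p (gen_schur Pm11 Pm12 Pm21 Pm22)"
    and "\<And>t. t \<le> T \<Longrightarrow> y t \<in> carrier_vec p"
    and "\<exists>P. data_generated_by p L T Pm y P"
    and "vec_space.rank (p * L) (H1 p L T y) = p * L"
  shows "(informative_quadratic_stability p L T Pm y \<longleftrightarrow>
            (\<exists>\<Phi>. pos_def (p * L) \<Phi> \<and> stability_lmi p L T Pm y \<Phi>)) \<and>
         (\<forall>\<Phi>. pos_def (p * L) \<Phi> \<and> stability_lmi p L T Pm y \<Phi> \<longrightarrow>
            (\<forall>P. compatible p L T Pm y P \<longrightarrow>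
               qdf_lyapunov p L P (the (mat_inverse \<Phi>))))"
proof -
  note p = assms(1) and L = assms(2) and LT = assms(3) and Pm = assms(4) and rank = assms(14)
  let ?n = "p * L"
  have neg: "quad_form (N_mat p L T Pm y) (0\<^sub>v p @\<^sub>v w) < 0" if w: "w \<in> carrier_vec ?n" "w \<noteq> 0\<^sub>v ?n" for w
  proof -
    let ?v = "transpose_mat (H1 p L T y) *\<^sub>v w"
    have "?v \<noteq> 0\<^sub>v (T - L + 1)"
      using full_row_rank_transpose_injective[OF H1_carrier rank w(1)] w(2) by blast
    moreover have "?v \<in> carrier_vec (T - L + 1)" using H1_carrier[of p L T y] w by simp
    ultimately have "quad_form Pm22 ?v < 0" using assms(10) by (simp add: neg_def_iff_quad_form)
    then show ?thesis
      using quad_form_N_mat_lower[OF Pm assms(5) sym_mat_carrier[OF assms(6)] assms(7,8)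
          sym_mat_carrier[OF assms(9)] w(1)] by simp
  qed
  obtain P0 where P0: "compatible p L T Pm y P0"
    using assms(13) data_generated_by_iff_compatible[OF _ LT assms(12) sym_mat_carrier[OF Pm]] p by auto
  have carrier: "P \<in> carrier_mat p ?n" if "compatible p L T Pm y P" for P
    using that by (simp add: compatible_def)
  have inverse_contraction: "\<exists>\<Psi>. mat_inverse \<Phi> = Some \<Psi> \<and> pos_def ?n \<Psi> \<and>
      (\<forall>P x. compatible p L T Pm y P \<longrightarrow> x \<in> carrier_vec ?n \<longrightarrow> x \<noteq> 0\<^sub>v ?n \<longrightarrow>
        quad_form \<Psi> (companion p L P *\<^sub>v x) < quad_form \<Psi> x)"
    if \<Phi>: "pos_def ?n \<Phi>" and lmi: "stability_lmi p L T Pm y \<Phi>" for \<Phi>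
  proof -
    have \<Phi>s: "\<Phi> \<in> sym_mat ?n" using \<Phi> by (simp add: pos_def_def)
    obtain \<Psi> where \<Psi>: "mat_inverse \<Phi> = Some \<Psi>" "pos_def ?n \<Psi>" "\<Phi> * \<Psi> = 1\<^sub>m ?n" "\<Psi> * \<Phi> = 1\<^sub>m ?n"
      using pos_def_mat_inverse[OF \<Phi>] .
    have "quad_form \<Psi> (companion p L P *\<^sub>v x) < quad_form \<Psi> x"
      if P: "compatible p L T Pm y P" and x: "x \<in> carrier_vec ?n" "x \<noteq> 0\<^sub>v ?n" for P x
      using contraction_inverse_form[OF \<Phi>s \<Psi>(2-4) companion_carrier[OF L carrier[OF P]]
          stability_lmi_imp_dual_contraction[OF L Pm \<Phi>s lmi P] x] .
    then show ?thesis using \<Psi> by blast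
  qed
  have "informative_quadratic_stability p L T Pm y"
    if \<Phi>: "pos_def ?n \<Phi>" "stability_lmi p L T Pm y \<Phi>" for \<Phi>
  proof -
    obtain \<Psi> where \<Psi>: "pos_def ?n \<Psi>" and contr: "\<And>P x. compatible p L T Pm y P \<Longrightarrow>
        x \<in> carrier_vec ?n \<Longrightarrow> x \<noteq> 0\<^sub>v ?n \<Longrightarrow> quad_form \<Psi> (companion p L P *\<^sub>v x) < quad_form \<Psi> x"
      using inverse_contraction[OF \<Phi>] by blast
    have \<Psi>s: "\<Psi> \<in> sym_mat ?n" using \<Psi> by (simp add: pos_def_def)
    have "quad_form \<Psi> x \<ge> 0" if "x \<in> carrier_vec ?n" for x
      using \<Psi> that sym_mat_carrier[OF \<Psi>s]
      by (cases "x = 0\<^sub>v ?n") (auto simp: pos_def_iff_quad_form less_imp_le)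
    then have "pos_semidef ?n \<Psi>" using \<Psi>s by (simp add: pos_semidef_iff_quad_form)
    then show ?thesis
      unfolding informative_quadratic_stability_def
      using contr carrier quadratic_stability_iff_contraction[OF L _ \<Psi>s] by blast
  qed
  moreover have "\<exists>\<Phi>. pos_def ?n \<Phi> \<and> stability_lmi p L T Pm y \<Phi>"
    if inf: "informative_quadratic_stability p L T Pm y"
  proof -
    obtain \<Psi> where psd: "pos_semidef ?n \<Psi>" and contr: "\<And>P x. compatible p L T Pm y P \<Longrightarrow>
        x \<in> carrier_vec ?n \<Longrightarrow> x \<noteq> 0\<^sub>v ?n \<Longrightarrow> quad_form \<Psi> (companion p L P *\<^sub>v x) < quad_form \<Psi> x"
    proof -
      obtain \<Psi> where psd: "pos_semidef ?n \<Psi>" and st: "\<forall>P. compatible p L T Pm y P \<longrightarrow>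
           neg_def ?n
             (transpose_mat (1\<^sub>m ?n @\<^sub>r (- P)) *
              (four_block_mat (0\<^sub>m p p) (0\<^sub>m p ?n) (0\<^sub>m ?n p) \<Psi> -
               four_block_mat \<Psi> (0\<^sub>m ?n p) (0\<^sub>m p ?n) (0\<^sub>m p p)) *
              (1\<^sub>m ?n @\<^sub>r (- P)))"
        using inf unfolding informative_quadratic_stability_def by blast
      have \<Psi>s: "\<Psi> \<in> sym_mat ?n" using psd by (simp add: pos_semidef_def)
      show ?thesis
        using st carrier quadratic_stability_iff_contraction[OF L _ \<Psi>s] by (intro that[OF psd]) blast
    qed
    have \<Psi>s: "\<Psi> \<in> sym_mat ?n" using psd by (simp add: pos_semidef_def)
    have "quad_form \<Psi> x > 0" if x: "x \<in> carrier_vec ?n" "x \<noteq> 0\<^sub>v ?n" for x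
    proof -
      have "0 \<le> quad_form \<Psi> (companion p L P0 *\<^sub>v x)"
        using psd companion_carrier[OF L carrier[OF P0]] x by (auto simp: pos_semidef_iff_quad_form)
      also have "\<dots> < quad_form \<Psi> x" using contr[OF P0 x] .
      finally show ?thesis .
    qed
    then have \<Psi>: "pos_def ?n \<Psi>" using \<Psi>s by (simp add: pos_def_iff_quad_form)
    obtain \<Phi> where \<Phi>: "pos_def ?n \<Phi>" "\<Psi> * \<Phi> = 1\<^sub>m ?n" "\<Phi> * \<Psi> = 1\<^sub>m ?n"
      using pos_def_mat_inverse[OF \<Psi>] by blast
    have "quad_form \<Phi> (transpose_mat (companion p L P) *\<^sub>v x) < quad_form \<Phi> x"
      if P: "compatible p L T Pm y P" and x: "x \<in> carrier_vec ?n" "x \<noteq> 0\<^sub>v ?n" for P x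
      using companion_carrier[OF L carrier[OF P]] contr[OF P]
      by (intro contraction_inverse_form[OF \<Psi>s \<Phi> _ _ x]) auto
    then obtain \<beta> where \<beta>: "\<beta> > 0" "stability_lmi p L T Pm y (\<beta> \<cdot>\<^sub>m \<Phi>)"
      using dual_contraction_imp_stability_lmi[OF L Pm \<Phi>(1) neg P0] by blast
    have \<Phi>s: "\<Phi> \<in> sym_mat ?n" using \<Phi> by (simp add: pos_def_def)
    have "pos_def ?n (\<beta> \<cdot>\<^sub>m \<Phi>)"
      using \<Phi>(1) \<beta>(1) sym_mat_smult[OF \<Phi>s] sym_mat_carrier[OF \<Phi>s]
      by (simp add: pos_def_iff_quad_form quad_form_smult_mat)
    then show ?thesis using \<beta>(2) by blast
  qed
  moreover have "qdf_lyapunov p L P (the (mat_inverse \<Phi>))"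
    if \<Phi>: "pos_def ?n \<Phi>" "stability_lmi p L T Pm y \<Phi>" and P: "compatible p L T Pm y P" for \<Phi> P
  proof -
    obtain \<Psi> where \<Psi>: "mat_inverse \<Phi> = Some \<Psi>" "pos_def ?n \<Psi>" and contr: "\<And>x.
        x \<in> carrier_vec ?n \<Longrightarrow> x \<noteq> 0\<^sub>v ?n \<Longrightarrow> quad_form \<Psi> (companion p L P *\<^sub>v x) < quad_form \<Psi> x"
      using inverse_contraction[OF \<Phi>] P by blast
    then show ?thesis
      using contraction_imp_qdf_lyapunov[OF p L carrier[OF P] \<Psi>(2) contr] by simp
  qed
  ultimately show ?thesis by blast
qed

end
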